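(* Let $\mathbb{L}$ be a complete, algebraically closed non-Archimedean field of characteristic $0$, and let $\phi$ be a rational map of degree $\geq 2$ defined over $\mathbb{L}$ having good reduction. Then the fixed point locus $\{\zeta \in \mathbb{P}^1_{an} : \phi(\zeta)=\zeta\}$ of $\phi$ in the Berkovich projective line $\mathbb{P}^1_{an}$ over $\mathbb{L}$ is connected if and only if the reduction $\tilde\phi$ of $\phi$ has no fixed critical point in $\mathbb{P}^1(\tilde{\mathbb{L}})$.
   Context: $\mathcal{O}_{\mathbb{L}}=\{|x|\le 1\}$ is the valuation ring, $m_{\mathbb{L}}$ its maximal ideal and $\tilde{\mathbb{L}}=\mathcal{O}_{\mathbb{L}}/m_{\mathbb{L}}$ the residue field. A normalized form of $\phi$ is a representation $\phi=F/G$ with $F,G$ coprime and all coefficients in $\mathcal{O}_{\mathbb{L}}$, not all in $m_{\mathbb{L}}$; reducing the coefficients modulo $m_{\mathbb{L}}$ and cancelling common factors gives the reduction $\tilde\phi$, a rational map over $\tilde{\mathbb{L}}$. $\phi$ has good reduction if $\deg\tilde\phi=\deg\phi$. A critical point of $\tilde\phi$ is a point of $\mathbb{P}^1(\tilde{\mathbb{L}})$ at which $\tilde\phi$ has multiplicity (local degree) at least $2$. The action of $\phi$ on $\mathbb{P}^1(\mathbb{L})$ extends uniquely and continuously to the Berkovich projective line $\mathbb{P}^1_{an}$ (with its weak/Berkovich topology), and connectedness is with respect to this topology. *)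

theory Defs
  imports "HOL-Analysis.Analysis" "HOL-Computational_Algebra.Polynomial"
begin

definition nonarch_abs :: "('a::field \<Rightarrow> real) \<Rightarrow> bool" where
  "nonarch_abs absv \<longleftrightarrow>
     (\<forall>x. 0 \<le> absv x) \<and> (\<forall>x. absv x = 0 \<longleftrightarrow> x = 0) \<and>
     (\<forall>x y. absv (x * y) = absv x * absv y) \<and>
     (\<forall>x y. absv (x + y) \<le> max (absv x) (absv y)) \<and>
     (\<exists>x. absv x \<noteq> 0 \<and> absv x \<noteq> 1)"

definition complete_abs :: "('a::field \<Rightarrow> real) \<Rightarrow> bool" where
  "complete_abs absv \<longleftrightarrow>
     (\<forall>X::nat \<Rightarrow> 'a. (\<forall>e>0. \<exists>N. \<forall>m\<ge>N. \<forall>n\<ge>N. absv (X m - X n) < e) \<longrightarrow>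
        (\<exists>l. \<forall>e>0. \<exists>N. \<forall>n\<ge>N. absv (X n - l) < e))"

definition alg_closed_field :: "'a::field itself \<Rightarrow> bool" where
  "alg_closed_field _ \<longleftrightarrow> (\<forall>p::'a poly. 0 < degree p \<longrightarrow> (\<exists>x. poly p x = 0))"

text \<open>A rational map is \<open>\<phi> = f/g\<close> with \<open>f, g\<close> coprime; as a map of \<open>\<P>\<^sup>1\<close> it is
  \<open>[X:Y] \<mapsto> [F(X,Y) : G(X,Y)]\<close> where \<open>F = Y\<^sup>d f(X/Y)\<close>, \<open>G = Y\<^sup>d g(X/Y)\<close>.
  In general a polynomial \<open>p\<close> with \<open>degree p \<le> n\<close> represents the binary form
  \<open>\<Sum> coeff p i X\<^sup>i Y\<^sup>n\<^sup>-\<^sup>i\<close> of degree \<open>n\<close>; products of forms correspond to products of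
  polynomials.\<close>
definition rat_deg :: "'a::field poly \<Rightarrow> 'a poly \<Rightarrow> nat" where
  "rat_deg f g = max (degree f) (degree g)"

definition integral_poly :: "('a::field \<Rightarrow> real) \<Rightarrow> 'a poly \<Rightarrow> bool" where
  "integral_poly absv p \<longleftrightarrow> (\<forall>i. absv (coeff p i) \<le> 1)"

definition nonzero_red :: "('a::field \<Rightarrow> real) \<Rightarrow> 'a poly \<Rightarrow> bool" where
  "nonzero_red absv p \<longleftrightarrow> (\<exists>i. absv (coeff p i) = 1)"

definition cong_m :: "('a::field \<Rightarrow> real) \<Rightarrow> 'a poly \<Rightarrow> 'a poly \<Rightarrow> bool" where
  "cong_m absv p q \<longleftrightarrow> (\<forall>i. absv (coeff p i - coeff q i) < 1)"

definition normalized :: "('a::field \<Rightarrow> real) \<Rightarrow> 'a poly \<Rightarrow> 'a poly \<Rightarrow> bool" where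
  "normalized absv f g \<longleftrightarrow> integral_poly absv f \<and> integral_poly absv g \<and>
     (nonzero_red absv f \<or> nonzero_red absv g)"

text \<open>Over the residue field: the reduction of the form \<open>h\<close> (of degree \<open>k\<close>) divides the
  reduction of the form \<open>p\<close> (of degree \<open>n\<close>).\<close>
definition red_form_dvd ::
  "('a::field \<Rightarrow> real) \<Rightarrow> nat \<Rightarrow> 'a poly \<Rightarrow> nat \<Rightarrow> 'a poly \<Rightarrow> bool" where
  "red_form_dvd absv k h n p \<longleftrightarrow>
     k \<le> n \<and> (\<exists>q. integral_poly absv q \<and> degree q \<le> n - k \<and> cong_m absv p (h * q))"

text \<open>Degree of the common factor of \<open>F~, G~\<close> (degree of their gcd over the residue field).\<close>
definition red_common_deg :: "('a::field \<Rightarrow> real) \<Rightarrow> 'a poly \<Rightarrow> 'a poly \<Rightarrow> nat" where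
  "red_common_deg absv f g = (GREATEST k. k \<le> rat_deg f g \<and>
     (\<exists>h. integral_poly absv h \<and> nonzero_red absv h \<and> degree h \<le> k \<and>
          red_form_dvd absv k h (rat_deg f g) f \<and> red_form_dvd absv k h (rat_deg f g) g))"

text \<open>Degree of the reduction \<open>\<phi>~\<close> (after cancelling common factors); \<open>f,g\<close> normalized.\<close>
definition red_deg :: "('a::field \<Rightarrow> real) \<Rightarrow> 'a poly \<Rightarrow> 'a poly \<Rightarrow> nat" where
  "red_deg absv f g = rat_deg f g - red_common_deg absv f g"

definition good_reduction :: "('a::field \<Rightarrow> real) \<Rightarrow> 'a poly \<Rightarrow> 'a poly \<Rightarrow> bool" where
  "good_reduction absv f g \<longleftrightarrow> red_deg absv f g = rat_deg f g"

definition hom_eval :: "nat \<Rightarrow> 'a::field poly \<Rightarrow> 'a \<Rightarrow> 'a \<Rightarrow> 'a" where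
  "hom_eval n p a b = (\<Sum>i\<le>n. coeff p i * a ^ i * b ^ (n - i))"

text \<open>A point \<open>[a:b]\<close> of \<open>\<P>\<^sup>1(L~)\<close> is represented by \<open>a, b \<in> O\<close> not both in \<open>m\<close>.
  For the reduced map \<open>[F':G']\<close> of degree \<open>n\<close> (forms \<open>f', g'\<close>), the point \<open>P = [a:b]\<close>
  is fixed iff \<open>[F'(P):G'(P)] = [a:b]\<close>, and critical iff the multiplicity of \<open>\<phi>~\<close> at \<open>P\<close>,
  i.e. the order of vanishing at \<open>P\<close> of \<open>e F' - c G'\<close> where \<open>(c,e) = (F'(P),G'(P))\<close>,
  i.e. the multiplicity of the linear factor \<open>bX - aY\<close>, is at least 2.\<close>
definition red_fixed_critical ::
  "('a::field \<Rightarrow> real) \<Rightarrow> nat \<Rightarrow> 'a poly \<Rightarrow> 'a poly \<Rightarrow> 'a \<Rightarrow> 'a \<Rightarrow> bool" where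
  "red_fixed_critical absv n f' g' a b \<longleftrightarrow>
     (let c = hom_eval n f' a b; e = hom_eval n g' a b in
        \<not> (absv c < 1 \<and> absv e < 1) \<and>
        absv (b * c - a * e) < 1 \<and>
        2 \<le> n \<and>
        red_form_dvd absv 2 ([:- a, b:] ^ 2) n (smult e f' - smult c g'))"

text \<open>The reduction \<open>\<phi>~ = F'/G'\<close> (obtained from \<open>F~ = H F'\<close>, \<open>G~ = H G'\<close> with \<open>H\<close> the
  common factor) has a fixed critical point in \<open>\<P>\<^sup>1(L~)\<close>.\<close>
definition red_has_fixed_crit :: "('a::field \<Rightarrow> real) \<Rightarrow> 'a poly \<Rightarrow> 'a poly \<Rightarrow> bool" where
  "red_has_fixed_crit absv f g \<longleftrightarrow>
     (let d = rat_deg f g; r = red_deg absv f g in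
      \<exists>h f' g'. integral_poly absv h \<and> nonzero_red absv h \<and> degree h \<le> d - r \<and>
        integral_poly absv f' \<and> integral_poly absv g' \<and> degree f' \<le> r \<and> degree g' \<le> r \<and>
        cong_m absv f (h * f') \<and> cong_m absv g (h * g') \<and>
        (\<exists>a b. absv a \<le> 1 \<and> absv b \<le> 1 \<and> max (absv a) (absv b) = 1 \<and>
               red_fixed_critical absv r f' g' a b))"

definition berk_A1 :: "('a::field \<Rightarrow> real) \<Rightarrow> ('a poly \<Rightarrow> real) set" where
  "berk_A1 absv = {\<zeta>. (\<forall>p. 0 \<le> \<zeta> p) \<and> (\<forall>p q. \<zeta> (p * q) = \<zeta> p * \<zeta> q) \<and>
      (\<forall>p q. \<zeta> (p + q) \<le> \<zeta> p + \<zeta> q) \<and> (\<forall>c. \<zeta> [:c:] = absv c)}"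

definition berk_A1_top :: "('a::field \<Rightarrow> real) \<Rightarrow> ('a poly \<Rightarrow> real) topology" where
  "berk_A1_top absv = subtopology
     (topology_generated_by {{\<zeta> \<in> berk_A1 absv. \<zeta> p \<in> U} | p U. open U}) (berk_A1 absv)"

text \<open>\<open>P\<^sup>1_an = A\<^sup>1_an \<union> {\<infinity>}\<close> (\<open>None\<close> is \<open>\<infinity>\<close>), the one-point compactification.\<close>
definition berk_P1 :: "('a::field \<Rightarrow> real) \<Rightarrow> ('a poly \<Rightarrow> real) option set" where
  "berk_P1 absv = insert None (Some ` berk_A1 absv)"

definition berk_P1_top :: "('a::field \<Rightarrow> real) \<Rightarrow> ('a poly \<Rightarrow> real) option topology" where
  "berk_P1_top absv = subtopology
     (topology_generated_by
        ({Some ` V | V. openin (berk_A1_top absv) V} \<union>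
         {insert None (Some ` (berk_A1 absv - K)) | K. compactin (berk_A1_top absv) K}))
     (berk_P1 absv)"

text \<open>Homogenised composition: \<open>p(f/g) = hom_comp p f g / g^(degree p)\<close>.\<close>
definition hom_comp :: "'a::field poly \<Rightarrow> 'a poly \<Rightarrow> 'a poly \<Rightarrow> 'a poly" where
  "hom_comp p f g = (\<Sum>i\<le>degree p. smult (coeff p i) (f ^ i * g ^ (degree p - i)))"

definition type1 :: "('a::field \<Rightarrow> real) \<Rightarrow> 'a \<Rightarrow> ('a poly \<Rightarrow> real)" where
  "type1 absv c = (\<lambda>p. absv (poly p c))"

text \<open>The (unique continuous) extension of \<open>\<phi> = f/g\<close> to \<open>P\<^sup>1_an\<close>:
  \<open>[p]_{\<phi>(\<zeta>)} = [p \<circ> \<phi>]_\<zeta>\<close>.\<close>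
definition berk_map ::
  "('a::field \<Rightarrow> real) \<Rightarrow> 'a poly \<Rightarrow> 'a poly \<Rightarrow> ('a poly \<Rightarrow> real) option \<Rightarrow> ('a poly \<Rightarrow> real) option" where
  "berk_map absv f g z = (case z of
      None \<Rightarrow> (if degree g < degree f then None
               else Some (type1 absv (coeff f (degree g) / lead_coeff g)))
    | Some \<zeta> \<Rightarrow> (if \<zeta> g = 0 then None
               else Some (\<lambda>p. \<zeta> (hom_comp p f g) / \<zeta> g ^ degree p)))"

definition berk_fixed_locus ::
  "('a::field \<Rightarrow> real) \<Rightarrow> 'a poly \<Rightarrow> 'a poly \<Rightarrow> ('a poly \<Rightarrow> real) option set" where
  "berk_fixed_locus absv f g = {z \<in> berk_P1 absv. berk_map absv f g z = z}"

end

theory Submission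
  imports Defs
begin

text \<open>A point \<open>z\<close> of \<open>\<P>\<^sup>1_an\<close> is described by its values on binary forms, scaled so that
  \<open>max |X|\<^sub>z |Y|\<^sub>z = 1\<close>; over an algebraically closed field the values on linear forms suffice.
  With \<open>\<parallel>l\<parallel>\<close> the Gauss norm, good reduction of \<open>\<Phi> = (F, G)\<close> gives
  \<open>max |F|\<^sub>z |G|\<^sub>z = 1\<close>, so \<open>z\<close> is fixed iff \<open>|l \<circ> \<Phi>|\<^sub>z = |l|\<^sub>z\<close> for all linear forms \<open>l\<close>.
  A fixed critical point of the reduction is a class \<open>[a:b]\<close> such that \<open>l = b X - a Y\<close> divides
  \<open>l \<circ> \<Phi>\<close> twice modulo the maximal ideal.

  Every \<open>z\<close> is joined to the Gauss point by the path \<open>z\<^sub>t\<close> with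
  \<open>|l|\<close> at \<open>z\<^sub>t\<close> equal to \<open>max |l|\<^sub>z (t \<parallel>l\<parallel>)\<close>. If \<open>z\<close> is fixed, \<open>\<parallel>l\<parallel> = 1\<close> and \<open>|l|\<^sub>z < 1\<close>, then
  \<open>l \<circ> \<Phi>\<close> vanishes at the residue class of the root of \<open>l\<close>, which is a fixed point of the
  reduction. If it is not critical, exactly one normalized linear factor \<open>m\<close> of \<open>l \<circ> \<Phi>\<close> vanishes
  there, hence \<open>|l \<circ> \<Phi>| = |m|\<close> along the whole path and all \<open>z\<^sub>t\<close> are fixed.

  Conversely, if the root of \<open>l\<close> is a fixed critical point of the reduction, then
  \<open>l \<circ> \<Phi> = l\<^sup>2 Q + E\<close> with \<open>\<parallel>E\<parallel> = \<rho> < 1\<close>, so a fixed \<open>z\<close> with \<open>|l|\<^sub>z < 1\<close> has \<open>|l|\<^sub>z \<le> \<rho>\<close>. The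
  continuous function \<open>z \<mapsto> |l|\<^sub>z\<close> thus omits the interval between \<open>\<rho>\<close> and \<open>1\<close> on the fixed locus,
  yet it takes the value \<open>1\<close> at the Gauss point and a smaller value at a zero of \<open>Y F - X G\<close>.\<close>

section \<open>Non-Archimedean absolute values\<close>

lemma mult_less_mult_if_one_less:
  fixes a b c d :: real
  assumes "0 \<le> a" "0 \<le> c" "0 < b" "0 < d" "a \<le> b" "c \<le> d" "a < b \<or> c < d"
  shows "a * c < b * d"
  using assms(7)
proof
  assume "a < b"
  have "a * c \<le> a * d"
    using assms(6,1) by (rule mult_left_mono)
  also have "\<dots> < b * d"
    using \<open>a < b\<close> assms(4) by simp
  finally show ?thesis .
next
  assume "c < d"
  have "a * c \<le> b * c"
    using assms(5,2) by (rule mult_right_mono)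
  also have "\<dots> < b * d"
    using \<open>c < d\<close> assms(3) by simp
  finally show ?thesis .
qed

locale nonarch_field =
  fixes absv :: "'a::field \<Rightarrow> real"
  assumes nonarch: "nonarch_abs absv"
begin

lemma absv_nonneg [simp]: "0 \<le> absv x"
  and absv_eq_0_iff [simp]: "absv x = 0 \<longleftrightarrow> x = 0"
  and absv_mult: "absv (x * y) = absv x * absv y"
  and absv_add_le: "absv (x + y) \<le> max (absv x) (absv y)"
  using nonarch by (auto simp: nonarch_abs_def)

lemma absv_0 [simp]: "absv 0 = 0"
  by simp

lemma absv_1 [simp]: "absv 1 = 1"
  using absv_mult[of 1 1] absv_eq_0_iff[of 1] by (simp del: absv_eq_0_iff)

lemma absv_pos_iff [simp]: "0 < absv x \<longleftrightarrow> x \<noteq> 0"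
  by (simp add: less_le)

lemma absv_le_0_iff [simp]: "absv x \<le> 0 \<longleftrightarrow> x = 0"
  by (simp add: order_antisym_conv)

lemma absv_minus [simp]: "absv (- x) = absv x"
proof -
  have "absv (-1) ^ 2 = 1"
    by (simp add: power2_eq_square flip: absv_mult)
  then have "absv (-1) = 1"
    by (metis absv_nonneg abs_of_nonneg power2_eq_1_iff abs_1 abs_minus_cancel)
  then show ?thesis
    using absv_mult[of "-1" x] by simp
qed

lemma absv_diff_commute: "absv (x - y) = absv (y - x)"
  using absv_minus[of "x - y"] by simp

lemma absv_power: "absv (x ^ n) = absv x ^ n"
  by (induction n) (auto simp: absv_mult)

lemma absv_divide: "absv (x / y) = absv x / absv y"
proof (cases "y = 0")
  case False
  then show ?thesis
    using absv_mult[of "x / y" y] by (simp add: field_simps)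
qed simp

lemma absv_diff_le: "absv (x - y) \<le> max (absv x) (absv y)"
  using absv_add_le[of x "- y"] by simp

lemma absv_add_eq: "absv y < absv x \<Longrightarrow> absv (x + y) = absv x"
  using absv_add_le[of x y] absv_diff_le[of "x + y" y] by (auto simp: max_def split: if_splits)

lemma absv_diff_eq: "absv x < absv y \<Longrightarrow> absv (x - y) = absv y"
  using absv_add_eq[of "- x" y] by (simp add: absv_diff_commute)

lemma absv_sum_le_member:
  assumes "finite A" "A \<noteq> {}"
  shows "\<exists>i\<in>A. absv (sum F A) \<le> absv (F i)"
  using assms
proof (induction rule: finite_ne_induct)
  case (insert x A)
  then obtain i where "i \<in> A" "absv (sum F A) \<le> absv (F i)"
    by blast
  then have "absv (F x + sum F A) \<le> absv (F x) \<or> absv (F x + sum F A) \<le> absv (F i)"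
    using absv_add_le[of "F x" "sum F A"] by linarith
  with insert.hyps \<open>i \<in> A\<close> show ?case
    by auto
qed simp

lemma absv_sum_dominant:
  assumes "finite A" "i \<in> A" "\<And>k. k \<in> A - {i} \<Longrightarrow> absv (F k) < absv (F i)"
  shows "absv (sum F A) = absv (F i)"
proof (cases "A = {i}")
  case False
  then obtain k where "k \<in> A - {i}" "absv (sum F (A - {i})) \<le> absv (F k)"
    using assms(1,2) absv_sum_le_member[of "A - {i}" F] by auto
  then have "absv (sum F (A - {i})) < absv (F i)"
    using assms(3) by force
  then show ?thesis
    by (simp add: sum.remove[OF assms(1,2)] absv_add_eq)
qed simp

lemma absv_of_nat_le_1: "absv (of_nat n) \<le> 1"
proof (induction n)
  case (Suc n)
  then show ?case
    using absv_add_le[of 1 "of_nat n"] by simp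
qed simp

definition unimodular :: "'a \<Rightarrow> 'a \<Rightarrow> bool" where
  "unimodular a b \<longleftrightarrow> max (absv a) (absv b) = 1"

lemma unimodular_le_1:
  assumes "unimodular a b"
  shows "absv a \<le> 1" "absv b \<le> 1"
  using assms by (auto simp: unimodular_def)

lemma unimodular_cases [consumes 1, case_names first second]:
  assumes "unimodular a b"
  obtains "absv a = 1" | "absv b = 1"
  using assms by (auto simp: unimodular_def max_def split: if_splits)

lemma unimodular_scaling:
  assumes "a \<noteq> 0 \<or> b \<noteq> 0"
  obtains k a' b' where "a = k * a'" "b = k * b'" "unimodular a' b'"
proof (cases "absv a \<le> absv b")
  case True
  then have "b \<noteq> 0"
    using assms absv_pos_iff[of a] by fastforce
  then show thesis
    using True by (intro that[of b "a / b" 1]) (auto simp: absv_divide unimodular_def)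
next
  case False
  then have "a \<noteq> 0"
    by auto
  then show thesis
    using False by (intro that[of a 1 "b / a"]) (auto simp: absv_divide unimodular_def)
qed

text \<open>The chordal distance between the points \<open>[a:b]\<close> and \<open>[c:e]\<close> of the projective line, given
  by unimodular coordinates. It is smaller than 1 iff the points have the same reduction.\<close>
definition chordal :: "'a \<Rightarrow> 'a \<Rightarrow> 'a \<Rightarrow> 'a \<Rightarrow> real" where
  "chordal a b c e = absv (b * c - a * e)"

lemma chordal_commute: "chordal a b c e = chordal c e a b"
  by (simp add: chordal_def absv_diff_commute[of "b * c"] mult.commute)

lemma chordal_le_1:
  assumes "unimodular a b" "unimodular c e"
  shows "chordal a b c e \<le> 1"
proof -
  have "absv (b * c) \<le> 1" "absv (a * e) \<le> 1"
    unfolding absv_mult using unimodular_le_1[OF assms(1)] unimodular_le_1[OF assms(2)]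
    by (auto intro!: mult_le_one)
  then show ?thesis
    using absv_diff_le[of "b * c" "a * e"] unfolding chordal_def by linarith
qed

section \<open>Gauss norms\<close>

definition gauss_norm :: "real \<Rightarrow> 'a poly \<Rightarrow> real" where
  "gauss_norm r p = Max ((\<lambda>i. absv (coeff p i) * r ^ i) ` {..degree p})"

lemma gauss_norm_attained:
  obtains i where "i \<le> degree p" "gauss_norm r p = absv (coeff p i) * r ^ i"
proof -
  have "gauss_norm r p \<in> (\<lambda>i. absv (coeff p i) * r ^ i) ` {..degree p}"
    unfolding gauss_norm_def by (rule Max_in) auto
  then show thesis
    using that by auto
qed

lemma gauss_norm_nonneg [simp]: "0 \<le> r \<Longrightarrow> 0 \<le> gauss_norm r p"
  by (metis gauss_norm_attained absv_nonneg mult_nonneg_nonneg zero_le_power)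

lemma coeff_le_gauss_norm: "0 \<le> r \<Longrightarrow> absv (coeff p i) * r ^ i \<le> gauss_norm r p"
proof (cases "i \<le> degree p")
  case True
  then show ?thesis
    by (auto simp: gauss_norm_def)
qed (simp add: coeff_eq_0)

lemma gauss_norm_le_iff:
  "0 \<le> r \<Longrightarrow> gauss_norm r p \<le> B \<longleftrightarrow> (\<forall>i. absv (coeff p i) * r ^ i \<le> B)"
  by (metis coeff_le_gauss_norm gauss_norm_attained order_trans)

lemma gauss_norm_less_iff:
  "0 \<le> r \<Longrightarrow> gauss_norm r p < B \<longleftrightarrow> (\<forall>i. absv (coeff p i) * r ^ i < B)"
  by (metis coeff_le_gauss_norm gauss_norm_attained order_le_less_trans)

lemma gauss_norm_const [simp]: "gauss_norm r [:c:] = absv c"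
  by (simp add: gauss_norm_def)

lemma gauss_norm_0_right [simp]: "gauss_norm r 0 = 0"
  by (simp add: gauss_norm_def)

lemma gauss_norm_pCons:
  assumes "0 \<le> r"
  shows "gauss_norm r (pCons a p) = max (absv a) (r * gauss_norm r p)"
proof (rule antisym)
  have "absv (coeff (pCons a p) i) * r ^ i \<le> max (absv a) (r * gauss_norm r p)" for i
  proof (cases i)
    case (Suc j)
    have "absv (coeff (pCons a p) i) * r ^ i = r * (absv (coeff p j) * r ^ j)"
      by (simp add: Suc)
    also have "\<dots> \<le> r * gauss_norm r p"
      using assms by (intro mult_left_mono coeff_le_gauss_norm)
    finally show ?thesis
      by simp
  qed simp
  then show "gauss_norm r (pCons a p) \<le> max (absv a) (r * gauss_norm r p)"
    using assms by (simp add: gauss_norm_le_iff)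
  obtain j where "gauss_norm r p = absv (coeff p j) * r ^ j"
    by (rule gauss_norm_attained)
  then have "r * gauss_norm r p \<le> gauss_norm r (pCons a p)"
    using coeff_le_gauss_norm[OF assms, of "pCons a p" "Suc j"] by (simp add: mult_ac)
  moreover have "absv a \<le> gauss_norm r (pCons a p)"
    using coeff_le_gauss_norm[OF assms, of "pCons a p" 0] by simp
  ultimately show "max (absv a) (r * gauss_norm r p) \<le> gauss_norm r (pCons a p)"
    by simp
qed

lemma gauss_norm_0_left: "gauss_norm 0 p = absv (coeff p 0)"
  by (cases p) (simp add: gauss_norm_pCons)

lemma gauss_norm_eq_0_iff [simp]: "0 < r \<Longrightarrow> gauss_norm r p = 0 \<longleftrightarrow> p = 0"
proof
  assume "0 < r" "gauss_norm r p = 0"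
  then have "absv (coeff p i) * r ^ i \<le> 0" for i
    using coeff_le_gauss_norm[of r p i] by simp
  with \<open>0 < r\<close> have "coeff p i = 0" for i
    by (metis absv_eq_0_iff absv_nonneg antisym mult_le_0_iff not_le zero_less_power)
  then show "p = 0"
    by (simp add: poly_eqI)
qed simp

lemma gauss_norm_add_le:
  assumes "0 \<le> r"
  shows "gauss_norm r (p + q) \<le> max (gauss_norm r p) (gauss_norm r q)"
  unfolding gauss_norm_le_iff[OF assms]
proof
  fix i
  have "absv (coeff (p + q) i) * r ^ i \<le> max (absv (coeff p i)) (absv (coeff q i)) * r ^ i"
    using assms by (intro mult_right_mono) (auto simp: absv_add_le)
  also have "\<dots> = max (absv (coeff p i) * r ^ i) (absv (coeff q i) * r ^ i)"
    using assms by (simp add: max_mult_distrib_right)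
  also have "\<dots> \<le> max (gauss_norm r p) (gauss_norm r q)"
    using assms by (meson coeff_le_gauss_norm max.mono)
  finally show "absv (coeff (p + q) i) * r ^ i \<le> max (gauss_norm r p) (gauss_norm r q)" .
qed

lemma absv_coeff_mult_term:
  assumes "k \<le> n"
  shows "absv (coeff p k * coeff q (n - k)) * r ^ n
    = (absv (coeff p k) * r ^ k) * (absv (coeff q (n - k)) * r ^ (n - k))"
proof -
  have "r ^ n = r ^ k * r ^ (n - k)"
    using assms by (simp flip: power_add)
  then show ?thesis
    by (simp add: absv_mult)
qed

lemma gauss_norm_mult_le:
  assumes "0 \<le> r"
  shows "gauss_norm r (p * q) \<le> gauss_norm r p * gauss_norm r q"
  unfolding gauss_norm_le_iff[OF assms]
proof
  fix n
  obtain k where "k \<le> n" "absv (coeff (p * q) n) \<le> absv (coeff p k * coeff q (n - k))"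
    using absv_sum_le_member[of "{..n}" "\<lambda>k. coeff p k * coeff q (n - k)"]
    by (auto simp: coeff_mult)
  then have "absv (coeff (p * q) n) * r ^ n
      \<le> (absv (coeff p k) * r ^ k) * (absv (coeff q (n - k)) * r ^ (n - k))"
    unfolding absv_coeff_mult_term[OF \<open>k \<le> n\<close>, symmetric] using assms
    by (intro mult_right_mono) auto
  also have "\<dots> \<le> gauss_norm r p * gauss_norm r q"
    using assms by (intro mult_mono coeff_le_gauss_norm) auto
  finally show "absv (coeff (p * q) n) * r ^ n \<le> gauss_norm r p * gauss_norm r q" .
qed

lemma gauss_norm_first_attained:
  assumes "0 \<le> r"
  obtains i where "absv (coeff p i) * r ^ i = gauss_norm r p"
    "\<And>k. k < i \<Longrightarrow> absv (coeff p k) * r ^ k < gauss_norm r p"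
proof -
  let ?attained = "\<lambda>i. absv (coeff p i) * r ^ i = gauss_norm r p"
  have "?attained (LEAST i. ?attained i)"
    by (rule LeastI_ex) (metis gauss_norm_attained)
  moreover have "absv (coeff p k) * r ^ k < gauss_norm r p" if "k < (LEAST i. ?attained i)" for k
    using not_less_Least[OF that] coeff_le_gauss_norm[OF assms, of p k] by simp
  ultimately show thesis
    by (rule that)
qed

text \<open>Among the terms of the coefficient of degree \<open>i + j\<close>, with \<open>i\<close> and \<open>j\<close> the first indices
  at which the two Gauss norms are attained, one term dominates all the others.\<close>
lemma gauss_norm_mult_ge:
  assumes "0 < r" "p \<noteq> 0" "q \<noteq> 0"
  shows "gauss_norm r p * gauss_norm r q \<le> gauss_norm r (p * q)"
proof -
  have nonneg: "0 \<le> r"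
    using assms by simp
  have pos: "0 < gauss_norm r p" "0 < gauss_norm r q"
    using assms by (simp_all add: less_le)
  obtain i where i_attains: "absv (coeff p i) * r ^ i = gauss_norm r p"
    and below_i: "\<And>k. k < i \<Longrightarrow> absv (coeff p k) * r ^ k < gauss_norm r p"
    using gauss_norm_first_attained[OF nonneg, of p] by blast
  obtain j where j_attains: "absv (coeff q j) * r ^ j = gauss_norm r q"
    and below_j: "\<And>k. k < j \<Longrightarrow> absv (coeff q k) * r ^ k < gauss_norm r q"
    using gauss_norm_first_attained[OF nonneg, of q] by blast
  define T where "T k = coeff p k * coeff q (i + j - k)" for k
  have norm_T_i: "absv (T i) * r ^ (i + j) = gauss_norm r p * gauss_norm r q"
    using absv_coeff_mult_term[of i "i + j" p q r] by (simp add: T_def i_attains j_attains)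
  have "absv (T k) < absv (T i)" if "k \<in> {..i + j} - {i}" for k
  proof -
    have "k < i \<or> i + j - k < j"
      using that by auto
    then have "(absv (coeff p k) * r ^ k) * (absv (coeff q (i + j - k)) * r ^ (i + j - k))
        < gauss_norm r p * gauss_norm r q"
      using below_i below_j pos nonneg
      by (intro mult_less_mult_if_one_less coeff_le_gauss_norm) auto
    then have "absv (T k) * r ^ (i + j) < absv (T i) * r ^ (i + j)"
      unfolding norm_T_i using that by (simp add: T_def absv_coeff_mult_term)
    then show ?thesis
      using assms(1) by simp
  qed
  then have "absv (coeff (p * q) (i + j)) = absv (T i)"
    unfolding coeff_mult T_def[symmetric] by (intro absv_sum_dominant) auto
  then show ?thesis
    using coeff_le_gauss_norm[OF nonneg, of "p * q" "i + j"] by (simp add: norm_T_i)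
qed

lemma gauss_norm_mult:
  assumes "0 \<le> r"
  shows "gauss_norm r (p * q) = gauss_norm r p * gauss_norm r q"
proof -
  consider (zero_radius) "r = 0" | (zero_factor) "p = 0 \<or> q = 0"
    | (generic) "0 < r" "p \<noteq> 0" "q \<noteq> 0"
    using assms by fastforce
  then show ?thesis
  proof cases
    case zero_radius
    then show ?thesis
      by (simp add: gauss_norm_0_left coeff_mult_0 absv_mult)
  next
    case zero_factor
    then show ?thesis
      by auto
  next
    case generic
    then show ?thesis
      by (intro antisym gauss_norm_mult_le gauss_norm_mult_ge) simp_all
  qed
qed

abbreviation gauss :: "'a poly \<Rightarrow> real" where
  "gauss \<equiv> gauss_norm 1"

lemma gauss_mult: "gauss (p * q) = gauss p * gauss q"
  by (simp add: gauss_norm_mult)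

lemma gauss_smult: "gauss (smult c p) = absv c * gauss p"
  using gauss_mult[of "[:c:]" p] by simp

lemma gauss_minus [simp]: "gauss (- p) = gauss p"
  using gauss_smult[of "-1" p] by simp

lemma gauss_diff_le: "gauss (p - q) \<le> max (gauss p) (gauss q)"
  using gauss_norm_add_le[of 1 p "- q"] by simp

lemma coeff_le_gauss: "absv (coeff p i) \<le> gauss p"
  using coeff_le_gauss_norm[of 1 p i] by simp

lemma gauss_monom [simp]: "gauss (monom c n) = absv c"
  by (induction n) (auto simp: monom_0 monom_Suc gauss_norm_pCons)

lemma gauss_norm_le_gauss_mult_power:
  assumes "1 \<le> r" "degree p \<le> n"
  shows "gauss_norm r p \<le> gauss p * r ^ n"
proof -
  obtain i where "i \<le> degree p" "gauss_norm r p = absv (coeff p i) * r ^ i"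
    by (rule gauss_norm_attained)
  moreover from this have "r ^ i \<le> r ^ n"
    using assms by (intro power_increasing) auto
  ultimately show ?thesis
    using assms(1) coeff_le_gauss[of p i] by (simp add: mult_mono)
qed

end

section \<open>Congruence modulo the maximal ideal\<close>

context nonarch_field
begin

lemma integral_poly_iff: "integral_poly absv p \<longleftrightarrow> gauss p \<le> 1"
  by (simp add: integral_poly_def gauss_norm_le_iff)

lemma cong_m_iff: "cong_m absv p q \<longleftrightarrow> gauss (p - q) < 1"
  by (simp add: cong_m_def gauss_norm_less_iff)

lemma gauss_eq_1_iff: "gauss p = 1 \<longleftrightarrow> integral_poly absv p \<and> nonzero_red absv p"
  unfolding integral_poly_iff nonzero_red_def
  by (metis antisym coeff_le_gauss gauss_norm_attained mult_1_right order_refl power_one)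

lemma cong_m_refl [simp]: "cong_m absv p p"
  by (simp add: cong_m_def)

lemma cong_m_trans: "cong_m absv p q \<Longrightarrow> cong_m absv q r \<Longrightarrow> cong_m absv p r"
  using gauss_norm_add_le[of 1 "p - q" "q - r"] by (simp add: cong_m_iff)

lemma cong_m_diff:
  "cong_m absv p p' \<Longrightarrow> cong_m absv q q' \<Longrightarrow> cong_m absv (p - q) (p' - q')"
  using gauss_diff_le[of "p - p'" "q - q'"] by (simp add: cong_m_iff algebra_simps)

lemma cong_m_mult:
  assumes "cong_m absv p p'" "cong_m absv q q'" "gauss p \<le> 1" "gauss q' \<le> 1"
  shows "cong_m absv (p * q) (p' * q')"
proof -
  have "gauss (p * (q - q')) < 1" "gauss ((p - p') * q') < 1"
    using assms mult_right_mono[of "gauss p" 1 "gauss (q - q')"]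
      mult_left_mono[of "gauss q'" 1 "gauss (p - p')"]
    by (simp_all add: cong_m_iff gauss_mult)
  moreover have "p * q - p' * q' = p * (q - q') + (p - p') * q'"
    by (simp add: algebra_simps)
  ultimately show ?thesis
    using gauss_norm_add_le[of 1 "p * (q - q')" "(p - p') * q'"] by (simp add: cong_m_iff)
qed

lemma cong_m_smult:
  assumes "absv (c - c') < 1" "cong_m absv p p'" "absv c \<le> 1" "gauss p' \<le> 1"
  shows "cong_m absv (smult c p) (smult c' p')"
  using assms cong_m_mult[of "[:c:]" "[:c':]" p p'] by (simp add: cong_m_iff)

lemma cong_m_gauss_eq_1:
  assumes "cong_m absv p q" "gauss p = 1"
  shows "gauss q = 1"
  using assms gauss_diff_le[of p "p - q"] gauss_norm_add_le[of 1 "p - q" q]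
  by (simp add: cong_m_iff)

lemma red_form_dvdI:
  assumes "k \<le> n" "gauss q \<le> 1" "degree q \<le> n - k" "cong_m absv p (h * q)"
  shows "red_form_dvd absv k h n p"
  using assms by (auto simp: red_form_dvd_def integral_poly_iff)

lemma red_form_dvdE:
  assumes "red_form_dvd absv k h n p"
  obtains q where "k \<le> n" "gauss q \<le> 1" "degree q \<le> n - k" "cong_m absv p (h * q)"
  using assms by (auto simp: red_form_dvd_def integral_poly_iff)

lemma red_form_dvd_refl: "red_form_dvd absv n p n p"
  by (rule red_form_dvdI[of _ _ 1]) (auto simp: one_pCons)

lemma red_form_dvd_cong:
  "cong_m absv p p' \<Longrightarrow> red_form_dvd absv k h n p' \<Longrightarrow> red_form_dvd absv k h n p"
  by (meson cong_m_trans red_form_dvdE red_form_dvdI)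

lemma red_form_dvd_gauss_eq_1:
  assumes "red_form_dvd absv k h n p" "gauss p = 1" "gauss h \<le> 1"
  shows "gauss h = 1"
proof -
  obtain q where "gauss q \<le> 1" "cong_m absv p (h * q)"
    using assms(1) by (rule red_form_dvdE)
  then have "gauss h * gauss q = 1"
    using cong_m_gauss_eq_1 assms(2) by (simp flip: gauss_mult)
  then show ?thesis
    using mult_eq_1[of "gauss h" "gauss q"] assms(3) \<open>gauss q \<le> 1\<close> by simp
qed

lemma red_form_dvd_mult:
  assumes "red_form_dvd absv k h n p" "red_form_dvd absv k' h' n' p'"
    and "gauss p \<le> 1" "gauss h' \<le> 1"
  shows "red_form_dvd absv (k + k') (h * h') (n + n') (p * p')"
proof -
  obtain q where quotient: "k \<le> n" "gauss q \<le> 1" "degree q \<le> n - k" "cong_m absv p (h * q)"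
    using assms(1) by (rule red_form_dvdE)
  obtain q' where quotient':
    "k' \<le> n'" "gauss q' \<le> 1" "degree q' \<le> n' - k'" "cong_m absv p' (h' * q')"
    using assms(2) by (rule red_form_dvdE)
  show ?thesis
  proof (rule red_form_dvdI)
    show "k + k' \<le> n + n'" "degree (q * q') \<le> n + n' - (k + k')"
      using quotient quotient' degree_mult_le[of q q'] by linarith+
    show "gauss (q * q') \<le> 1"
      using quotient quotient' by (simp add: gauss_mult mult_le_one)
    have "cong_m absv (p * p') (h * q * (h' * q'))"
      using quotient quotient' assms by (intro cong_m_mult) (simp_all add: gauss_mult mult_le_one)
    then show "cong_m absv (p * p') (h * h' * (q * q'))"
      by (simp only: ac_simps)
  qed
qed

lemma red_form_dvd_smult:
  assumes "red_form_dvd absv k h n p" "absv c \<le> 1" "gauss p \<le> 1" "gauss h \<le> 1"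
  shows "red_form_dvd absv k h n (smult c p)"
proof -
  have "red_form_dvd absv 0 1 0 [:c:]"
    using assms by (intro red_form_dvdI[of _ _ "[:c:]"]) auto
  from red_form_dvd_mult[OF this assms(1)] assms show ?thesis
    by simp
qed

end

section \<open>Binary forms\<close>

lemma coeff_mult_at_degree_bounds:
  assumes "degree p \<le> m" "degree q \<le> n"
  shows "coeff (p * q) (m + n) = coeff p m * coeff q n"
proof -
  have "coeff p i * coeff q (m + n - i) = (if i = m then coeff p m * coeff q n else 0)" for i
    using assms by (cases i m rule: linorder_cases) (auto simp: coeff_eq_0)
  then show ?thesis
    by (simp add: coeff_mult)
qed

lemma hom_eval_eq_poly:
  assumes "degree p \<le> n" "b \<noteq> 0"
  shows "hom_eval n p a b = b ^ n * poly p (a / b)"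
proof -
  have "poly p (a / b) = (\<Sum>i\<le>n. coeff p i * (a / b) ^ i)"
    unfolding poly_altdef using assms(1)
    by (intro sum.mono_neutral_left) (auto simp: coeff_eq_0)
  then show ?thesis
    using assms(2)
    by (auto intro!: sum.cong simp: hom_eval_def sum_distrib_left power_divide power_diff mult_ac)
qed

lemma hom_eval_at_infinity: "hom_eval n p a 0 = coeff p n * a ^ n"
proof -
  have "hom_eval n p a 0 = (\<Sum>i\<le>n. if i = n then coeff p n * a ^ n else 0)"
    unfolding hom_eval_def by (rule sum.cong) auto
  then show ?thesis
    by simp
qed

lemma hom_eval_mult:
  assumes "degree p \<le> m" "degree q \<le> n"
  shows "hom_eval (m + n) (p * q) a b = hom_eval m p a b * hom_eval n q a b"
proof (cases "b = 0")
  case True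
  then show ?thesis
    using assms by (simp add: hom_eval_at_infinity coeff_mult_at_degree_bounds power_add)
next
  case False
  moreover have "degree (p * q) \<le> m + n"
    using assms degree_mult_le[of p q] by linarith
  ultimately show ?thesis
    using assms by (simp add: hom_eval_eq_poly power_add)
qed

lemma hom_eval_diff: "hom_eval n (p - q) a b = hom_eval n p a b - hom_eval n q a b"
  and hom_eval_smult: "hom_eval n (smult c p) a b = c * hom_eval n p a b"
  by (simp_all add: hom_eval_def algebra_simps sum_subtractf sum_distrib_left)

lemma hom_eval_const: "hom_eval 0 [:c:] a b = c"
  by (simp add: hom_eval_def)

text \<open>The linear form \<open>b X - a Y\<close> with zero \<open>[a:b]\<close>.\<close>
definition lin :: "'a::field \<Rightarrow> 'a \<Rightarrow> 'a poly" where
  "lin a b = [:- a, b:]"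

lemma degree_lin: "degree (lin a b) \<le> 1"
  by (simp add: lin_def)

lemma lin_mult_left: "lin (k * a) (k * b) = smult k (lin a b)"
  by (simp add: lin_def)

lemma lin_add: "lin (a + c) (b + e) = lin a b + lin c e"
  by (simp add: lin_def)

lemma lin_diff: "lin (a - c) (b - e) = lin a b - lin c e"
  by (simp add: lin_def)

lemma degree_lin_mult: "degree p \<le> n \<Longrightarrow> degree (lin a b * p) \<le> Suc n"
  using degree_mult_le[of "lin a b" p] degree_lin[of a b] by linarith

lemma hom_eval_lin_mult:
  "degree p \<le> n \<Longrightarrow> hom_eval (Suc n) (lin a b * p) x y = (b * x - a * y) * hom_eval n p x y"
  using hom_eval_mult[OF degree_lin, of p n a b x y] by (simp add: hom_eval_def[of "Suc 0"] lin_def)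

text \<open>The form \<open>l \<circ> (F, G)\<close> for \<open>l = b X - a Y\<close>.\<close>
definition pencil :: "'a::field \<Rightarrow> 'a \<Rightarrow> 'a poly \<Rightarrow> 'a poly \<Rightarrow> 'a poly" where
  "pencil a b f g = smult b f - smult a g"

lemma degree_pencil: "degree f \<le> n \<Longrightarrow> degree g \<le> n \<Longrightarrow> degree (pencil a b f g) \<le> n"
  unfolding pencil_def by (meson degree_diff_le degree_smult_le order_trans)

lemma pencil_mult_left: "pencil (k * a) (k * b) f g = smult k (pencil a b f g)"
  by (simp add: pencil_def smult_diff_right)

lemma hom_eval_pencil:
  "hom_eval n (pencil a b f g) x y = b * hom_eval n f x y - a * hom_eval n g x y"
  by (simp add: pencil_def hom_eval_diff hom_eval_smult)

context nonarch_field
begin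

lemma gauss_lin: "gauss (lin a b) = max (absv a) (absv b)"
  by (simp add: lin_def gauss_norm_pCons)

lemma gauss_lin_unimodular: "unimodular a b \<Longrightarrow> gauss (lin a b) = 1"
  by (simp add: gauss_lin unimodular_def)

lemma gauss_lin_mult: "unimodular a b \<Longrightarrow> gauss (lin a b * p) = gauss p"
  by (simp add: gauss_mult gauss_lin_unimodular)

lemma absv_hom_eval_lin_mult:
  "degree p \<le> n \<Longrightarrow>
    absv (hom_eval (Suc n) (lin a b * p) x y) = chordal a b x y * absv (hom_eval n p x y)"
  by (simp add: hom_eval_lin_mult chordal_def absv_mult)

lemma absv_hom_eval_le_gauss:
  assumes "unimodular a b"
  shows "absv (hom_eval n p a b) \<le> gauss p"
proof -
  obtain i where "absv (hom_eval n p a b) \<le> absv (coeff p i * a ^ i * b ^ (n - i))"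
    using absv_sum_le_member[of "{..n}" "\<lambda>i. coeff p i * a ^ i * b ^ (n - i)"]
    by (auto simp: hom_eval_def)
  also have "\<dots> = absv (coeff p i) * (absv a ^ i * absv b ^ (n - i))"
    by (simp add: absv_mult absv_power)
  also have "\<dots> \<le> gauss p * 1"
    using unimodular_le_1[OF assms]
    by (intro mult_mono coeff_le_gauss mult_le_one power_le_one) auto
  finally show ?thesis
    by simp
qed

lemma absv_hom_eval_less_1_if_red_form_dvd:
  assumes "red_form_dvd absv k h n p" "degree h \<le> k" "unimodular a b" "hom_eval k h a b = 0"
  shows "absv (hom_eval n p a b) < 1"
proof -
  obtain q where quotient: "k \<le> n" "degree q \<le> n - k" "cong_m absv p (h * q)"
    using assms(1) by (rule red_form_dvdE)
  have "hom_eval n (h * q) a b = 0"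
    using hom_eval_mult[OF assms(2) quotient(2), of a b] quotient(1) assms(4) by simp
  then have "hom_eval n p a b = hom_eval n (p - h * q) a b"
    by (simp add: hom_eval_diff)
  also have "absv \<dots> \<le> gauss (p - h * q)"
    by (rule absv_hom_eval_le_gauss[OF assms(3)])
  also have "\<dots> < 1"
    using quotient(3) by (simp add: cong_m_iff)
  finally show ?thesis .
qed

lemma proportional_up_to_chordal:
  assumes "unimodular a b"
  obtains u where "absv u \<le> max (absv c) (absv e)"
    "absv (c - u * a) \<le> chordal a b c e" "absv (e - u * b) \<le> chordal a b c e"
  using assms
proof (cases rule: unimodular_cases)
  case first
  then have "a \<noteq> 0"
    by auto
  then have "e - c / a * b = - ((b * c - a * e) / a)"
    by (simp add: field_simps)
  with \<open>a \<noteq> 0\<close> first show thesis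
    by (intro that[of "c / a"]) (simp_all add: absv_divide chordal_def)
next
  case second
  then have "b \<noteq> 0"
    by auto
  then have "c - e / b * a = (b * c - a * e) / b"
    by (simp add: field_simps)
  with \<open>b \<noteq> 0\<close> second show thesis
    by (intro that[of "e / b"]) (simp_all add: absv_divide chordal_def)
qed

lemma proportional_mod_m:
  assumes unimod: "unimodular a b" "unimodular c e" and near: "chordal a b c e < 1"
  obtains u where "absv u = 1" "absv (c - u * a) < 1" "absv (e - u * b) < 1"
proof -
  obtain u where "absv u \<le> max (absv c) (absv e)" and
    approx: "absv (c - u * a) \<le> chordal a b c e" "absv (e - u * b) \<le> chordal a b c e"
    using proportional_up_to_chordal[OF unimod(1)] by blast
  then have "absv u \<le> 1"
    using unimod(2) by (simp add: unimodular_def)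
  moreover have "1 \<le> absv u"
  proof (rule ccontr)
    assume "\<not> 1 \<le> absv u"
    then have "absv (u * a) < 1" "absv (u * b) < 1"
      using unimodular_le_1[OF unimod(1)] mult_left_le[of "absv a" "absv u"]
        mult_left_le[of "absv b" "absv u"] by (simp_all add: absv_mult)
    then have "absv c < 1" "absv e < 1"
      using absv_add_le[of "c - u * a" "u * a"] absv_add_le[of "e - u * b" "u * b"] approx near
      by simp_all
    then show False
      using unimod(2) by (simp add: unimodular_def)
  qed
  ultimately show thesis
    using that approx near by fastforce
qed

lemma lin_cong_m:
  assumes "unimodular a b" "unimodular c e" "chordal a b c e < 1"
  obtains u where "absv u = 1" "cong_m absv (lin c e) (smult u (lin a b))"
proof -
  obtain u where "absv u = 1" "absv (c - u * a) < 1" "absv (e - u * b) < 1"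
    using proportional_mod_m[OF assms] .
  moreover have "lin c e - smult u (lin a b) = lin (c - u * a) (e - u * b)"
    by (simp add: lin_diff lin_mult_left)
  ultimately show thesis
    using that by (simp add: cong_m_iff gauss_lin)
qed

lemma gauss_pencil_le:
  assumes "gauss f \<le> 1" "gauss g \<le> 1"
  shows "gauss (pencil a b f g) \<le> max (absv a) (absv b)"
proof -
  have "absv a * gauss g \<le> absv a" "absv b * gauss f \<le> absv b"
    using assms by (auto intro: mult_left_le)
  then show ?thesis
    using gauss_diff_le[of "smult b f" "smult a g"] unfolding pencil_def gauss_smult by linarith
qed

lemma cong_m_pencil:
  assumes "cong_m absv f f'" "cong_m absv g g'" "absv a \<le> 1" "absv b \<le> 1"
    and "gauss f' \<le> 1" "gauss g' \<le> 1"
  shows "cong_m absv (pencil a b f g) (pencil a b f' g')"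
  unfolding pencil_def using assms by (intro cong_m_diff cong_m_smult) simp_all

lemma red_form_dvd_pencil_transfer:
  assumes unimod: "unimodular a b" "unimodular c e" and near: "chordal a b c e < 1"
    and "gauss f \<le> 1" "gauss g \<le> 1" "gauss h \<le> 1"
    and "red_form_dvd absv k h n (pencil a b f g)"
  shows "red_form_dvd absv k h n (pencil c e f g)"
proof -
  obtain u where scalar: "absv u = 1" "absv (c - u * a) < 1" "absv (e - u * b) < 1"
    using proportional_mod_m[OF unimod near] .
  have "cong_m absv (smult e f) (smult (u * b) f)" "cong_m absv (smult c g) (smult (u * a) g)"
    using scalar assms unimodular_le_1[OF unimod(2)] by (simp_all add: cong_m_smult)
  then have "cong_m absv (pencil c e f g) (pencil (u * a) (u * b) f g)"
    unfolding pencil_def by (rule cong_m_diff)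
  moreover have "gauss (pencil a b f g) \<le> 1"
    using gauss_pencil_le[of f g a b] assms(4,5) unimod(1) by (simp add: unimodular_def)
  then have "red_form_dvd absv k h n (pencil (u * a) (u * b) f g)"
    unfolding pencil_mult_left using assms scalar by (intro red_form_dvd_smult) simp_all
  ultimately show ?thesis
    by (rule red_form_dvd_cong)
qed

lemma absv_hom_eval_less_1_if_square_dvd:
  assumes "unimodular a b" and "red_form_dvd absv 2 (lin a b ^ 2) n p"
  shows "absv (hom_eval n p a b) < 1"
proof -
  have "degree (lin a b ^ 2) \<le> 2"
    using degree_power_le[of "lin a b" 2] degree_lin[of a b] by linarith
  moreover have "hom_eval 2 (lin a b ^ 2) a b = 0"
    using hom_eval_lin_mult[OF degree_lin, of a b a b a b]
    by (simp add: power2_eq_square numeral_2_eq_2)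
  ultimately show ?thesis
    using absv_hom_eval_less_1_if_red_form_dvd assms by blast
qed

lemma red_fixed_critical_iff:
  assumes unimod: "unimodular a b" and "gauss f \<le> 1" "gauss g \<le> 1" "2 \<le> n"
  shows "red_fixed_critical absv n f g a b
    \<longleftrightarrow> unimodular (hom_eval n f a b) (hom_eval n g a b)
      \<and> red_form_dvd absv 2 (lin a b ^ 2) n (pencil a b f g)"
proof -
  define c where "c = hom_eval n f a b"
  define e where "e = hom_eval n g a b"
  have "absv c \<le> 1" "absv e \<le> 1"
    using absv_hom_eval_le_gauss[OF unimod] assms(2,3) unfolding c_def e_def by (meson order_trans)+
  then have "\<not> (absv c < 1 \<and> absv e < 1) \<longleftrightarrow> unimodular c e"
    by (auto simp: unimodular_def max_def)
  then have "red_fixed_critical absv n f g a b \<longleftrightarrow> unimodular c e \<and> chordal a b c e < 1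
      \<and> red_form_dvd absv 2 (lin a b ^ 2) n (pencil c e f g)"
    using assms(4)
    by (simp add: red_fixed_critical_def Let_def c_def e_def chordal_def lin_def pencil_def)
  moreover have "chordal a b c e < 1" if "red_form_dvd absv 2 (lin a b ^ 2) n (pencil a b f g)"
    using absv_hom_eval_less_1_if_square_dvd[OF unimod that]
    by (simp add: hom_eval_pencil chordal_def c_def e_def)
  moreover have "red_form_dvd absv 2 (lin a b ^ 2) n (pencil a b f g)
      \<longleftrightarrow> red_form_dvd absv 2 (lin a b ^ 2) n (pencil c e f g)"
    if "unimodular c e" "chordal a b c e < 1"
  proof -
    have "chordal c e a b < 1"
      using that(2) by (simp add: chordal_commute)
    moreover have "gauss (lin a b ^ 2) \<le> 1"
      by (simp add: power2_eq_square gauss_mult gauss_lin_unimodular[OF unimod])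
    ultimately show ?thesis
      using red_form_dvd_pencil_transfer[OF unimod that assms(2,3)]
        red_form_dvd_pencil_transfer[OF that(1) unimod _ assms(2,3)] by blast
  qed
  ultimately show ?thesis
    unfolding c_def[symmetric] e_def[symmetric] by blast
qed

end

section \<open>Norms of binary forms at points of the Berkovich line\<close>

lemma le_1_if_powers_le_linear:
  fixes x :: real
  assumes "\<And>n. x ^ n \<le> real n + 1"
  shows "x \<le> 1"
proof (rule ccontr)
  assume "\<not> x \<le> 1"
  then have "(\<lambda>n. real n / x ^ n + 1 / x ^ n) \<longlonglongrightarrow> 0 + 0"
    by (intro tendsto_add lim_n_over_pown LIMSEQ_divide_realpow_zero) auto
  moreover have "1 \<le> real n / x ^ n + 1 / x ^ n" for n
  proof -
    have "0 < x ^ n"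
      using \<open>\<not> x \<le> 1\<close> by simp
    then show ?thesis
      using assms[of n] by (simp add: add_divide_distrib[symmetric])
  qed
  ultimately have "1 \<le> 0 + (0::real)"
    by (intro LIMSEQ_le_const) auto
  then show False
    by simp
qed

context nonarch_field
begin

lemma berk_A1_nonneg: "\<zeta> \<in> berk_A1 absv \<Longrightarrow> 0 \<le> \<zeta> p"
  and berk_A1_mult: "\<zeta> \<in> berk_A1 absv \<Longrightarrow> \<zeta> (p * q) = \<zeta> p * \<zeta> q"
  and berk_A1_add: "\<zeta> \<in> berk_A1 absv \<Longrightarrow> \<zeta> (p + q) \<le> \<zeta> p + \<zeta> q"
  and berk_A1_const: "\<zeta> \<in> berk_A1 absv \<Longrightarrow> \<zeta> [:c:] = absv c"
  by (auto simp: berk_A1_def)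

lemma berk_A1_smult: "\<zeta> \<in> berk_A1 absv \<Longrightarrow> \<zeta> (smult c p) = absv c * \<zeta> p"
  using berk_A1_mult[of \<zeta> "[:c:]" p] by (simp add: berk_A1_const)

lemma berk_A1_0: "\<zeta> \<in> berk_A1 absv \<Longrightarrow> \<zeta> 0 = 0"
  using berk_A1_const[of \<zeta> 0] by simp

lemma berk_A1_power: "\<zeta> \<in> berk_A1 absv \<Longrightarrow> \<zeta> (p ^ n) = \<zeta> p ^ n"
  using berk_A1_const[of \<zeta> 1] by (induction n) (auto simp: berk_A1_mult one_pCons)

lemma berk_A1_sum_le: "\<zeta> \<in> berk_A1 absv \<Longrightarrow> \<zeta> (sum F A) \<le> (\<Sum>i\<in>A. \<zeta> (F i))"
proof (induction A rule: infinite_finite_induct)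
  case (insert x A)
  then show ?case
    using berk_A1_add[of \<zeta> "F x" "sum F A"] by simp
qed (simp_all add: berk_A1_0)

lemma berk_A1_add_power_le:
  assumes point: "\<zeta> \<in> berk_A1 absv" and bound: "\<zeta> p \<le> M" "\<zeta> q \<le> M"
  shows "\<zeta> (p + q) ^ n \<le> (real n + 1) * M ^ n"
proof -
  have term_le: "\<zeta> (of_nat (n choose k) * p ^ k * q ^ (n - k)) \<le> M ^ n" if "k \<le> n" for k
  proof -
    have "\<zeta> (of_nat (n choose k) * p ^ k * q ^ (n - k))
        = absv (of_nat (n choose k)) * (\<zeta> p ^ k * \<zeta> q ^ (n - k))"
      using point by (simp add: berk_A1_mult berk_A1_power of_nat_poly berk_A1_smult)
    also have "\<dots> \<le> 1 * (M ^ k * M ^ (n - k))"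
      using bound berk_A1_nonneg[OF point] order_trans[OF berk_A1_nonneg[OF point] bound(1)]
      by (intro mult_mono power_mono absv_of_nat_le_1) auto
    also have "\<dots> = M ^ n"
      using that by (simp flip: power_add)
    finally show ?thesis .
  qed
  have "\<zeta> (p + q) ^ n = \<zeta> (\<Sum>k\<le>n. of_nat (n choose k) * p ^ k * q ^ (n - k))"
    using point by (simp add: binomial_ring flip: berk_A1_power)
  also have "\<dots> \<le> (\<Sum>k\<le>n. \<zeta> (of_nat (n choose k) * p ^ k * q ^ (n - k)))"
    using point by (rule berk_A1_sum_le)
  also have "\<dots> \<le> (\<Sum>k\<le>n. M ^ n)"
    by (intro sum_mono term_le) auto
  finally show ?thesis
    by (simp add: algebra_simps)
qed

lemma berk_A1_ultrametric:
  assumes point: "\<zeta> \<in> berk_A1 absv"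
  shows "\<zeta> (p + q) \<le> max (\<zeta> p) (\<zeta> q)"
proof -
  define M where "M = max (\<zeta> p) (\<zeta> q)"
  have power_le: "\<zeta> (p + q) ^ n \<le> (real n + 1) * M ^ n" for n
    by (intro berk_A1_add_power_le[OF point]) (simp_all add: M_def)
  have "0 \<le> M"
    using berk_A1_nonneg[OF point, of p] by (simp add: M_def)
  show "\<zeta> (p + q) \<le> M"
  proof (cases "M = 0")
    case True
    then show ?thesis
      using power_le[of 1] by simp
  next
    case False
    with \<open>0 \<le> M\<close> have "0 < M"
      by simp
    then have "\<zeta> (p + q) / M \<le> 1"
      using power_le by (intro le_1_if_powers_le_linear) (simp add: power_divide divide_le_eq)
    then show ?thesis
      using \<open>0 < M\<close> by (simp add: divide_le_eq)
  qed
qed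

lemma berk_A1_le_gauss_norm:
  assumes point: "\<zeta> \<in> berk_A1 absv" and radius: "\<zeta> [:0, 1:] \<le> r"
  shows "\<zeta> p \<le> gauss_norm r p"
proof (induction p)
  case 0
  then show ?case
    by (simp add: berk_A1_0[OF point])
next
  case (pCons a p)
  have "0 \<le> r"
    using berk_A1_nonneg[OF point] radius by (rule order_trans)
  have "\<zeta> ([:0, 1:] * p) \<le> r * gauss_norm r p"
    unfolding berk_A1_mult[OF point]
    using radius pCons.IH \<open>0 \<le> r\<close> berk_A1_nonneg[OF point] by (intro mult_mono)
  moreover have "\<zeta> (pCons a p) \<le> max (absv a) (\<zeta> ([:0, 1:] * p))"
    using berk_A1_ultrametric[OF point, of "[:a:]" "[:0, 1:] * p"]
    by (simp add: berk_A1_const[OF point])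
  ultimately show ?case
    using \<open>0 \<le> r\<close> by (simp add: gauss_norm_pCons)
qed

definition coord_norm :: "('a poly \<Rightarrow> real) \<Rightarrow> real" where
  "coord_norm \<zeta> = max 1 (\<zeta> [:0, 1:])"

lemma coord_norm_ge_1: "1 \<le> coord_norm \<zeta>"
  by (simp add: coord_norm_def)

lemma coord_norm_pos [simp]: "0 < coord_norm \<zeta>"
  and coord_norm_nonneg [simp]: "0 \<le> coord_norm \<zeta>"
  and coord_norm_neq_0 [simp]: "coord_norm \<zeta> \<noteq> 0"
  using coord_norm_ge_1[of \<zeta>] by auto

text \<open>The value at \<open>z\<close> of the form of degree \<open>n\<close> represented by \<open>p\<close>, scaled so that
  \<open>max |X|\<^sub>z |Y|\<^sub>z = 1\<close>; meaningful for \<open>degree p \<le> n\<close> only.\<close>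
definition form_norm :: "('a poly \<Rightarrow> real) option \<Rightarrow> nat \<Rightarrow> 'a poly \<Rightarrow> real" where
  "form_norm z n p = (case z of None \<Rightarrow> absv (coeff p n)
     | Some \<zeta> \<Rightarrow> \<zeta> p / coord_norm \<zeta> ^ n)"

lemma form_norm_None [simp]: "form_norm None n p = absv (coeff p n)"
  and form_norm_Some: "form_norm (Some \<zeta>) n p = \<zeta> p / coord_norm \<zeta> ^ n"
  by (simp_all add: form_norm_def)

lemma berk_P1_cases [consumes 1, case_names None Some]:
  assumes "z \<in> berk_P1 absv"
  obtains "z = None" | \<zeta> where "z = Some \<zeta>" "\<zeta> \<in> berk_A1 absv"
  using assms by (auto simp: berk_P1_def)

lemma form_norm_nonneg: "z \<in> berk_P1 absv \<Longrightarrow> 0 \<le> form_norm z n p"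
  by (cases z rule: berk_P1_cases) (auto simp: form_norm_Some berk_A1_nonneg)

lemma form_norm_smult:
  "z \<in> berk_P1 absv \<Longrightarrow> form_norm z n (smult c p) = absv c * form_norm z n p"
  by (cases z rule: berk_P1_cases) (auto simp: form_norm_Some berk_A1_smult absv_mult)

lemma form_norm_const: "z \<in> berk_P1 absv \<Longrightarrow> form_norm z 0 [:c:] = absv c"
  by (cases z rule: berk_P1_cases) (auto simp: form_norm_Some berk_A1_const)

lemma form_norm_mult:
  assumes "z \<in> berk_P1 absv" "degree p \<le> m" "degree q \<le> n"
  shows "form_norm z (m + n) (p * q) = form_norm z m p * form_norm z n q"
  using assms
  by (cases z rule: berk_P1_cases)
    (auto simp: form_norm_Some berk_A1_mult coeff_mult_at_degree_bounds absv_mult power_add)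

lemma form_norm_add_le:
  assumes "z \<in> berk_P1 absv"
  shows "form_norm z n (p + q) \<le> max (form_norm z n p) (form_norm z n q)"
  using assms
proof (cases z rule: berk_P1_cases)
  case (Some \<zeta>)
  have "\<zeta> (p + q) / coord_norm \<zeta> ^ n \<le> max (\<zeta> p) (\<zeta> q) / coord_norm \<zeta> ^ n"
    using berk_A1_ultrametric[OF Some(2)] by (rule divide_right_mono) simp
  also have "\<dots> = max (\<zeta> p / coord_norm \<zeta> ^ n) (\<zeta> q / coord_norm \<zeta> ^ n)"
    by (simp add: max_divide_distrib_right)
  finally show ?thesis
    by (simp only: Some(1) form_norm_Some)
qed (simp add: absv_add_le)

lemma form_norm_le_gauss:
  assumes "z \<in> berk_P1 absv" "degree p \<le> n"
  shows "form_norm z n p \<le> gauss p"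
  using assms(1)
proof (cases z rule: berk_P1_cases)
  case None
  then show ?thesis
    by (simp add: coeff_le_gauss)
next
  case (Some \<zeta>)
  have "\<zeta> p \<le> gauss_norm (coord_norm \<zeta>) p"
    using Some(2) by (rule berk_A1_le_gauss_norm) (simp add: coord_norm_def)
  also have "\<dots> \<le> gauss p * coord_norm \<zeta> ^ n"
    using coord_norm_ge_1 assms(2) by (rule gauss_norm_le_gauss_mult_power)
  finally show ?thesis
    by (simp add: Some(1) form_norm_Some pos_divide_le_eq)
qed

text \<open>For unimodular \<open>a, b\<close> this is the chordal distance from \<open>z\<close> to the classical point \<open>[a:b]\<close>.\<close>
definition lin_norm :: "('a poly \<Rightarrow> real) option \<Rightarrow> 'a \<Rightarrow> 'a \<Rightarrow> real" where
  "lin_norm z a b = form_norm z 1 (lin a b)"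

lemma lin_norm_None [simp]: "lin_norm None a b = absv b"
  and lin_norm_Some: "lin_norm (Some \<zeta>) a b = \<zeta> (lin a b) / coord_norm \<zeta>"
  by (simp_all add: lin_norm_def form_norm_Some) (simp add: lin_def)

lemma lin_norm_nonneg: "z \<in> berk_P1 absv \<Longrightarrow> 0 \<le> lin_norm z a b"
  by (simp add: lin_norm_def form_norm_nonneg)

lemma lin_norm_mult_left:
  "z \<in> berk_P1 absv \<Longrightarrow> lin_norm z (k * a) (k * b) = absv k * lin_norm z a b"
  by (simp add: lin_norm_def lin_mult_left form_norm_smult)

lemma lin_norm_add_le:
  "z \<in> berk_P1 absv \<Longrightarrow> lin_norm z (a + c) (b + e) \<le> max (lin_norm z a b) (lin_norm z c e)"
  by (simp add: lin_norm_def lin_add form_norm_add_le)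

lemma lin_norm_le: "z \<in> berk_P1 absv \<Longrightarrow> lin_norm z a b \<le> max (absv a) (absv b)"
  unfolding lin_norm_def by (metis degree_lin form_norm_le_gauss gauss_lin)

lemma lin_norm_le_1: "z \<in> berk_P1 absv \<Longrightarrow> unimodular a b \<Longrightarrow> lin_norm z a b \<le> 1"
  by (metis lin_norm_le unimodular_def)

lemma form_norm_lin_mult:
  "z \<in> berk_P1 absv \<Longrightarrow> degree p \<le> n \<Longrightarrow>
    form_norm z (Suc n) (lin a b * p) = lin_norm z a b * form_norm z n p"
  using form_norm_mult[OF _ degree_lin, of z p n a b] by (simp add: lin_norm_def)

lemma form_norm_square_mult_le:
  assumes point: "z \<in> berk_P1 absv" and "gauss q \<le> 1" "degree q \<le> n"
  shows "form_norm z (2 + n) (lin a b ^ 2 * q) \<le> (lin_norm z a b)\<^sup>2"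
proof -
  have "form_norm z (2 + n) (lin a b ^ 2 * q) = lin_norm z a b ^ 2 * form_norm z n q"
    using assms by (simp add: power2_eq_square form_norm_lin_mult degree_lin_mult mult.assoc)
  also have "\<dots> \<le> lin_norm z a b ^ 2 * 1"
    using form_norm_le_gauss[OF point assms(3)] assms(2) by (intro mult_left_mono) auto
  finally show ?thesis
    by simp
qed

lemma max_lin_norm_coordinates:
  "z \<in> berk_P1 absv \<Longrightarrow> max (lin_norm z 1 0) (lin_norm z 0 1) = 1"
  by (cases z rule: berk_P1_cases)
    (auto simp: lin_norm_Some lin_def berk_A1_const coord_norm_def max_def)

text \<open>By the next two lemmas, the ultrametric inequality holds for the triangle with vertices \<open>z\<close>,
  \<open>[a:b]\<close> and \<open>[c:e]\<close>.\<close>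
lemma chordal_le_max_lin_norm:
  assumes point: "z \<in> berk_P1 absv" and unimod: "unimodular a b" "unimodular c e"
  shows "chordal a b c e \<le> max (lin_norm z a b) (lin_norm z c e)"
proof -
  define v where "v = b * c - a * e"
  have combination:
    "lin_norm z (x * a + y * c) (x * b + y * e) \<le> max (lin_norm z a b) (lin_norm z c e)"
    if "absv x \<le> 1" "absv y \<le> 1" for x y
  proof -
    have "lin_norm z (x * a + y * c) (x * b + y * e)
        \<le> max (absv x * lin_norm z a b) (absv y * lin_norm z c e)"
      unfolding lin_norm_mult_left[OF point, symmetric] by (rule lin_norm_add_le[OF point])
    also have "\<dots> \<le> max (lin_norm z a b) (lin_norm z c e)"
      using that by (intro max.mono mult_left_le_one_le lin_norm_nonneg[OF point]) auto
    finally show ?thesis .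
  qed
  have "chordal a b c e = max (absv v * lin_norm z 1 0) (absv v * lin_norm z 0 1)"
    unfolding max_mult_distrib_left[of "absv v", simplified, symmetric]
      max_lin_norm_coordinates[OF point] by (simp add: chordal_def v_def)
  also have "absv v * lin_norm z 1 0 = lin_norm z (- e * a + b * c) (- e * b + b * e)"
    using lin_norm_mult_left[OF point, of v 1 0] by (simp add: v_def mult.commute)
  also have "absv v * lin_norm z 0 1 = lin_norm z (c * a + - a * c) (c * b + - a * e)"
    using lin_norm_mult_left[OF point, of v 0 1] by (simp add: v_def mult.commute)
  finally show ?thesis
    using combination[of "- e" b] combination[of c "- a"] unimodular_le_1[OF unimod(1)]
      unimodular_le_1[OF unimod(2)] by simp
qed

lemma lin_norm_le_max_chordal:
  assumes point: "z \<in> berk_P1 absv" and unimod: "unimodular a b" "unimodular c e"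
  shows "lin_norm z a b \<le> max (lin_norm z c e) (chordal a b c e)"
proof -
  obtain u where u_le: "absv u \<le> max (absv a) (absv b)"
    and approx: "absv (a - u * c) \<le> chordal c e a b" "absv (b - u * e) \<le> chordal c e a b"
    using proportional_up_to_chordal[OF unimod(2)] by blast
  have "absv u * lin_norm z c e \<le> lin_norm z c e"
    using u_le unimod(1)
    by (intro mult_left_le_one_le lin_norm_nonneg[OF point]) (auto simp: unimodular_def)
  moreover have "lin_norm z (a - u * c) (b - u * e) \<le> chordal a b c e"
    using lin_norm_le[OF point, of "a - u * c" "b - u * e"] approx
    by (simp add: chordal_commute[of a b])
  moreover have "lin_norm z (u * c + (a - u * c)) (u * e + (b - u * e))
      \<le> max (absv u * lin_norm z c e) (lin_norm z (a - u * c) (b - u * e))"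
    unfolding lin_norm_mult_left[OF point, symmetric] by (rule lin_norm_add_le[OF point])
  ultimately show ?thesis
    by simp
qed

lemma max_lin_norm_eq_max_chordal:
  assumes "z \<in> berk_P1 absv" "unimodular a b" "unimodular c e" "lin_norm z c e \<le> t"
  shows "max (lin_norm z a b) t = max (chordal a b c e) t"
  using chordal_le_max_lin_norm[OF assms(1-3)] lin_norm_le_max_chordal[OF assms(1-3)] assms(4)
  by linarith

section \<open>Discs\<close>

definition disc :: "'a \<Rightarrow> real \<Rightarrow> 'a poly \<Rightarrow> real" where
  "disc c r p = gauss_norm r (pcompose p [:c, 1:])"

lemma disc_in_berk_A1:
  assumes "0 \<le> r"
  shows "disc c r \<in> berk_A1 absv"
proof -
  have "disc c r (p + q) \<le> disc c r p + disc c r q" for p q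
    using assms gauss_norm_add_le[of r "pcompose p [:c, 1:]" "pcompose q [:c, 1:]"]
      gauss_norm_nonneg[of r "pcompose p [:c, 1:]"] gauss_norm_nonneg[of r "pcompose q [:c, 1:]"]
    by (simp add: disc_def pcompose_add le_max_iff_disj del: gauss_norm_nonneg, linarith)
  then show ?thesis
    using assms by (simp add: berk_A1_def pcompose_mult pcompose_const gauss_norm_mult disc_def)
qed

lemma lin_norm_disc:
  assumes "0 \<le> r"
  shows "lin_norm (Some (disc x r)) a b
    = max (absv (b * x - a)) (absv b * r) / max 1 (max (absv x) r)"
  using assms
  by (simp add: lin_norm_Some coord_norm_def disc_def lin_def pcompose_pCons gauss_norm_pCons
      mult.commute[of r])

lemma gauss_in_berk_P1: "Some gauss \<in> berk_P1 absv"
  using disc_in_berk_A1[of 1 0] by (simp add: berk_P1_def disc_def[abs_def])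

lemma form_norm_gauss: "form_norm (Some gauss) n p = gauss p"
  by (simp add: form_norm_Some coord_norm_def gauss_norm_pCons)

lemma lin_norm_gauss: "unimodular a b \<Longrightarrow> lin_norm (Some gauss) a b = 1"
  by (simp add: lin_norm_def form_norm_gauss gauss_lin_unimodular)

text \<open>The disc of radius \<open>t\<close> around \<open>[c:e]\<close> in the chordal metric. Its complement is an open disc of
  the affine line if \<open>|e| < t\<close>. Otherwise it is a disc of the affine line on which the chordal
  metric is \<open>|e|\<^sup>2\<close> times the affine one.\<close>
definition chordal_disc :: "'a \<Rightarrow> 'a \<Rightarrow> real \<Rightarrow> ('a poly \<Rightarrow> real) option" where
  "chordal_disc c e t =
    (if absv e < t then Some (disc 0 (1 / t))
     else if e = 0 then None
     else Some (disc (c / e) (t / (absv e)\<^sup>2)))"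

lemma chordal_disc_in_berk_P1: "0 \<le> t \<Longrightarrow> chordal_disc c e t \<in> berk_P1 absv"
  by (auto simp: chordal_disc_def berk_P1_def disc_in_berk_A1)

lemma lin_norm_disc_ge:
  assumes "0 \<le> r" "unimodular a b" and scale: "N = max 1 (max (absv x) r)"
  shows "r / N\<^sup>2 \<le> lin_norm (Some (disc x r)) a b"
proof -
  have "1 \<le> N" "absv x \<le> N" "r \<le> N"
    by (simp_all add: scale)
  have "r / N \<le> max (absv (b * x - a)) (absv b * r)"
  proof (cases "1 \<le> absv b * N")
    case True
    then have "r \<le> absv b * N * r"
      using assms(1) mult_right_mono[of 1 "absv b * N" r] by simp
    then show ?thesis
      using \<open>1 \<le> N\<close> by (simp add: le_max_iff_disj divide_le_eq mult_ac)
  next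
    case False
    then have "absv b < 1" "absv (b * x) < 1"
      using \<open>1 \<le> N\<close> mult_left_mono[OF \<open>1 \<le> N\<close>, of "absv b"]
        mult_left_mono[OF \<open>absv x \<le> N\<close>, of "absv b"]
      by (simp_all add: absv_mult)
    then have "absv (b * x - a) = 1"
      using assms(2) unimodular_cases[of a b] absv_diff_eq[of "b * x" a] by fastforce
    moreover have "r / N \<le> 1"
      using \<open>1 \<le> N\<close> \<open>r \<le> N\<close> by (simp add: divide_le_eq)
    ultimately show ?thesis
      by simp
  qed
  then have "r / N / N \<le> max (absv (b * x - a)) (absv b * r) / N"
    using \<open>1 \<le> N\<close> by (intro divide_right_mono) auto
  then show ?thesis
    using assms(1) by (simp add: lin_norm_disc scale power2_eq_square)
qed

lemma lin_norm_disc_eq_max_chordal: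
  assumes "0 \<le> r" "unimodular a b" "unimodular c e" "N = max 1 (max (absv x) r)"
    and center: "lin_norm (Some (disc x r)) c e \<le> r / N\<^sup>2"
  shows "lin_norm (Some (disc x r)) a b = max (chordal a b c e) (r / N\<^sup>2)"
proof -
  have "Some (disc x r) \<in> berk_P1 absv"
    using assms(1) by (simp add: berk_P1_def disc_in_berk_A1)
  then show ?thesis
    using max_lin_norm_eq_max_chordal[OF _ assms(2,3) center] lin_norm_disc_ge[OF assms(1,2,4)]
    by (metis max.absorb1)
qed

lemma lin_norm_chordal_disc_near_infinity:
  assumes "absv e < t" "t \<le> 1" and unimod: "unimodular c e" "unimodular a b"
  shows "lin_norm (chordal_disc c e t) a b = max (chordal a b c e) t"
proof -
  have "0 < t"
    using absv_nonneg assms(1) by (rule le_less_trans)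
  then have radius: "0 \<le> 1 / t" and scale: "1 / t = max 1 (max (absv 0) (1 / t))"
    using assms(2) by (auto simp: max_def field_simps)
  have "lin_norm (Some (disc 0 (1 / t))) c e = max (absv c) (absv e / t) * t"
    unfolding lin_norm_disc[OF radius] scale[symmetric] by simp
  also have "\<dots> \<le> 1 * t"
    using assms(1) \<open>0 < t\<close> unimodular_le_1[OF unimod(1)] by (intro mult_right_mono) auto
  finally show ?thesis
    using lin_norm_disc_eq_max_chordal[OF radius unimod(2,1) scale] assms(1) \<open>0 < t\<close>
    by (simp add: chordal_disc_def power2_eq_square)
qed

lemma lin_norm_chordal_disc_affine:
  assumes "0 \<le> t" "t \<le> absv e" "e \<noteq> 0" and unimod: "unimodular c e" "unimodular a b"
  shows "lin_norm (chordal_disc c e t) a b = max (chordal a b c e) t"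
proof -
  define s where "s = absv e"
  have s_bounds: "0 < s" "t \<le> s" "s \<le> 1"
    using assms(2,3) unimodular_le_1[OF unimod(1)] by (auto simp: s_def)
  have "max 1 (absv (c / e)) = 1 / s"
    using unimod(1) s_bounds
    by (auto simp: unimodular_def absv_divide s_def max_def field_simps split: if_splits)
  moreover have radius: "0 \<le> t / s\<^sup>2" and "t / s\<^sup>2 \<le> 1 / s"
    using s_bounds assms(1) by (simp_all add: power2_eq_square field_simps)
  ultimately have scale: "1 / s = max 1 (max (absv (c / e)) (t / s\<^sup>2))"
    by linarith
  have "lin_norm (Some (disc (c / e) (t / s\<^sup>2))) c e = s * (t / s\<^sup>2) / (1 / s)"
    unfolding lin_norm_disc[OF radius] scale[symmetric] using assms(1,3) s_bounds
    by (simp add: s_def)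
  then show ?thesis
    using lin_norm_disc_eq_max_chordal[OF radius unimod(2,1) scale] assms(2,3) s_bounds
    by (simp add: chordal_disc_def power2_eq_square flip: s_def)
qed

lemma lin_norm_chordal_disc:
  assumes "0 \<le> t" "t \<le> 1" and unimod: "unimodular c e" "unimodular a b"
  shows "lin_norm (chordal_disc c e t) a b = max (chordal a b c e) t"
proof -
  consider (near_infinity) "absv e < t" | (infinity) "e = 0" "t = 0"
    | (affine) "t \<le> absv e" "e \<noteq> 0"
    using assms(1) by fastforce
  then show ?thesis
  proof cases
    case near_infinity
    then show ?thesis
      using assms by (simp add: lin_norm_chordal_disc_near_infinity)
  next
    case infinity
    then show ?thesis
      using unimod(1) by (simp add: chordal_disc_def chordal_def unimodular_def absv_mult)
  next
    case affine
    then show ?thesis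
      using assms by (simp add: lin_norm_chordal_disc_affine)
  qed
qed

end

section \<open>Factorization of forms\<close>

locale alg_closed_nonarch_field = nonarch_field absv for absv :: "'a::field \<Rightarrow> real" +
  assumes alg_closed: "alg_closed_field TYPE('a)"
begin

lemma monic_linear_factor:
  fixes p :: "'a poly"
  assumes "degree p = Suc n"
  obtains c q where "p = lin c 1 * q" "degree q = n" "q \<noteq> 0"
proof -
  have "0 < degree p"
    using assms by simp
  then obtain c where "poly p c = 0"
    using alg_closed unfolding alg_closed_field_def by blast
  then obtain q where factor: "p = [:- c, 1:] * q"
    by (auto simp: poly_eq_0_iff_dvd)
  with assms have "q \<noteq> 0"
    by auto
  moreover from this have "degree p = Suc (degree q)"
    unfolding factor by (subst degree_mult_eq) auto
  ultimately show thesis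
    using factor assms that by (simp add: lin_def)
qed

lemma unimodular_linear_factor:
  assumes "degree p \<le> Suc n"
  obtains a b q where "unimodular a b" "degree q \<le> n" "p = lin a b * q"
proof (cases "degree p = Suc n")
  case True
  then obtain c q where factor: "p = lin c 1 * q" "degree q = n"
    using monic_linear_factor by blast
  obtain k a b where scaling: "c = k * a" "1 = k * b" "unimodular a b"
    using unimodular_scaling[of c 1] by auto
  then have "p = lin a b * smult k q"
    using lin_mult_left[of k a b] by (simp add: factor(1))
  with factor(2) scaling(3) show thesis
    by (intro that[of a b "smult k q"]) auto
next
  case False
  have "p = lin (-1) 0 * p"
    by (simp add: lin_def)
  with False assms show thesis
    by (intro that[of "-1" 0 p]) (simp_all add: unimodular_def)
qed

lemma form_induct [consumes 1, case_names const lin_mult]: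
  assumes "degree p \<le> n"
    and const: "\<And>c. Q 0 [:c:]"
    and lin_mult: "\<And>n a b q. \<lbrakk>unimodular a b; degree q \<le> n; Q n q\<rbrakk> \<Longrightarrow> Q (Suc n) (lin a b * q)"
  shows "Q n p"
  using assms(1)
proof (induction n arbitrary: p)
  case 0
  then show ?case
    by (metis const degree_eq_zeroE le_zero_eq)
next
  case (Suc n)
  then obtain a b q where "unimodular a b" "degree q \<le> n" "p = lin a b * q"
    using unimodular_linear_factor by blast
  with Suc.IH show ?case
    by (simp add: lin_mult)
qed

lemma form_factor_near_zero:
  assumes "degree p \<le> n" and unimod: "unimodular a b"
    and "gauss p = 1" "absv (hom_eval n p a b) < 1"
  obtains m c e q where "n = Suc m" "degree q \<le> m" "gauss q = 1" "unimodular c e"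
    "chordal a b c e < 1" "p = lin c e * q"
proof -
  have "\<exists>m c e q. n = Suc m \<and> degree q \<le> m \<and> gauss q = 1 \<and> unimodular c e
      \<and> chordal a b c e < 1 \<and> p = lin c e * q"
    using assms(1,3,4)
  proof (induction rule: form_induct)
    case (const c)
    then show ?case
      by (simp add: hom_eval_const)
  next
    case (lin_mult n c e q)
    have gauss_q: "gauss q = 1"
      using lin_mult by (simp add: gauss_lin_mult)
    show ?case
    proof (cases "chordal a b c e < 1")
      case True
      then show ?thesis
        using lin_mult gauss_q by blast
    next
      case False
      then have "chordal c e a b = 1"
        using chordal_le_1[OF unimod lin_mult(1)] by (simp add: chordal_commute)
      then have "absv (hom_eval n q a b) < 1"
        using lin_mult by (simp add: absv_hom_eval_lin_mult)
      then obtain m c' e' q' where factor: "n = Suc m" "degree q' \<le> m" "gauss q' = 1"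
        "unimodular c' e'" "chordal a b c' e' < 1" "q = lin c' e' * q'"
        using lin_mult.IH gauss_q by blast
      then have "lin c e * q = lin c' e' * (lin c e * q')"
        by (simp only: mult.left_commute)
      with factor lin_mult(1) show ?thesis
        by (metis degree_lin_mult gauss_lin_mult)
    qed
  qed
  with that show thesis
    by blast
qed

lemma red_form_dvd_lin:
  assumes degree: "degree p \<le> n" "0 < n" and unimod: "unimodular a b"
    and reduction: "gauss p \<le> 1" "absv (hom_eval n p a b) < 1"
  shows "red_form_dvd absv 1 (lin a b) n p"
proof (cases "gauss p = 1")
  case False
  with assms show ?thesis
    by (intro red_form_dvdI[of _ _ 0]) (simp_all add: cong_m_iff)
next
  case True
  obtain m c e q where factor: "n = Suc m" "degree q \<le> m" "gauss q = 1" "unimodular c e"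
    "chordal a b c e < 1" "p = lin c e * q"
    by (rule form_factor_near_zero[OF degree(1) unimod True reduction(2)])
  obtain u where scalar: "absv u = 1" "cong_m absv (lin c e) (smult u (lin a b))"
    using lin_cong_m[OF unimod factor(4,5)] .
  have "cong_m absv p (smult u (lin a b) * q)"
    unfolding factor(6) using scalar factor
    by (intro cong_m_mult) (simp_all add: gauss_lin_unimodular)
  then have "cong_m absv p (lin a b * smult u q)"
    by simp
  with scalar factor show ?thesis
    by (intro red_form_dvdI[of _ _ "smult u q"])
      (auto simp: gauss_smult intro: order_trans[OF degree_smult_le])
qed

lemma form_norm_eq_1_if_hom_eval_unit:
  assumes "degree p \<le> n" and point: "z \<in> berk_P1 absv" and unimod: "unimodular a b"
    and near: "lin_norm z a b < 1"
    and "gauss p \<le> 1" "absv (hom_eval n p a b) = 1"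
  shows "form_norm z n p = 1"
  using assms(1,5,6)
proof (induction rule: form_induct)
  case (const c)
  then show ?case
    using point by (simp add: form_norm_const hom_eval_const)
next
  case (lin_mult n c e q)
  have gauss_q: "gauss q \<le> 1"
    using lin_mult by (simp add: gauss_lin_mult)
  have "chordal a b c e * absv (hom_eval n q a b) = 1"
    using lin_mult by (simp add: absv_hom_eval_lin_mult chordal_commute)
  moreover have "absv (hom_eval n q a b) \<le> 1"
    using absv_hom_eval_le_gauss[OF unimod] gauss_q by (rule order_trans)
  ultimately have "chordal a b c e = 1" "absv (hom_eval n q a b) = 1"
    using mult_eq_1[of "chordal a b c e"] chordal_le_1[OF unimod lin_mult(1)]
    by (auto simp: chordal_def)
  then have "lin_norm z c e = 1" "form_norm z n q = 1"
    using chordal_le_max_lin_norm[OF point unimod lin_mult(1)] lin_norm_le_1[OF point lin_mult(1)]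
      near lin_mult.IH gauss_q by auto
  then show ?case
    using lin_mult point by (simp add: form_norm_lin_mult)
qed

lemma form_norm_mono:
  assumes "degree p \<le> n" and points: "z \<in> berk_P1 absv" "z' \<in> berk_P1 absv"
    and "\<And>a b. unimodular a b \<Longrightarrow> lin_norm z a b \<le> lin_norm z' a b"
  shows "form_norm z n p \<le> form_norm z' n p"
  using assms(1)
proof (induction rule: form_induct)
  case (const c)
  then show ?case
    using points by (simp add: form_norm_const)
next
  case (lin_mult n a b q)
  then show ?case
    using assms(4)[of a b] points
    by (simp add: form_norm_lin_mult mult_mono form_norm_nonneg lin_norm_nonneg)
qed

lemma form_norm_chordal_disc_0:
  assumes "degree p \<le> n" and unimod: "unimodular c e"
  shows "form_norm (chordal_disc c e 0) n p = absv (hom_eval n p c e)"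
  using assms(1)
proof (induction rule: form_induct)
  case (const a)
  then show ?case
    by (simp add: form_norm_const hom_eval_const chordal_disc_in_berk_P1)
next
  case (lin_mult n a b q)
  then show ?case
    by (simp add: form_norm_lin_mult absv_hom_eval_lin_mult chordal_disc_in_berk_P1
        lin_norm_chordal_disc[OF _ _ unimod] chordal_def)
qed

lemma berk_P1_eqI:
  assumes points: "z \<in> berk_P1 absv" "z' \<in> berk_P1 absv"
    and "\<And>a b. unimodular a b \<Longrightarrow> lin_norm z a b = lin_norm z' a b"
  shows "z = z'"
proof -
  have form_eq: "form_norm z n p = form_norm z' n p" if "degree p \<le> n" for n p
    using that points assms(3) by (intro antisym form_norm_mono) auto
  have Y_eq: "lin_norm z 1 0 = lin_norm z' 1 0"
    using assms(3)[of 1 0] by (simp add: unimodular_def)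
  have Y_Some: "lin_norm (Some \<zeta>) 1 0 = 1 / coord_norm \<zeta>" if "\<zeta> \<in> berk_A1 absv" for \<zeta>
    using that by (simp add: lin_norm_Some lin_def berk_A1_const)
  show ?thesis
    using points(1)
  proof (cases z rule: berk_P1_cases)
    case None
    with points(2) Y_eq show ?thesis
      by (cases rule: berk_P1_cases) (auto simp: Y_Some)
  next
    case (Some \<zeta>)
    then have "lin_norm z 1 0 \<noteq> 0"
      by (simp add: Y_Some)
    with points(2) Y_eq obtain \<zeta>' where Some': "z' = Some \<zeta>'" "\<zeta>' \<in> berk_A1 absv"
      by (cases rule: berk_P1_cases) auto
    have "coord_norm \<zeta> = coord_norm \<zeta>'"
      using Y_eq Y_Some Some Some' by simp
    then have "\<zeta> p = \<zeta>' p" for p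
      using form_eq[of p "degree p"] by (simp add: Some Some' form_norm_Some)
    then show ?thesis
      by (auto simp: Some Some')
  qed
qed

end

section \<open>Topology of the Berkovich line\<close>

lemma topology_generated_by_openin: "topology_generated_by {S. openin T S} = T"
proof -
  have "generate_topology_on {S. openin T S} S \<longleftrightarrow> openin T S" for S
    using generate_topology_on_coarsest[of "openin T" "{S. openin T S}" S]
    by (auto intro: generate_topology_on.Basis)
  then show ?thesis
    by (simp add: topology_eq openin_topology_generated_by_iff)
qed

lemma continuous_map_if_injection_compose:
  assumes "compact_space Y" "Hausdorff_space Z" "continuous_map Y Z f" "inj_on f (topspace Y)"
    and into: "h \<in> topspace X \<rightarrow> topspace Y" and "continuous_map X Z (f \<circ> h)"
  shows "continuous_map X Y h"
proof -
  let ?inverse = "inv_into (topspace Y) f"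
  have "continuous_map (subtopology Z (f ` topspace Y)) Y ?inverse"
    using assms(1-4) by (intro continuous_inverse_map) auto
  moreover have "continuous_map X (subtopology Z (f ` topspace Y)) (f \<circ> h)"
    using assms(6) into by (auto simp: continuous_map_in_subtopology)
  ultimately have "continuous_map X Y (?inverse \<circ> (f \<circ> h))"
    by (rule continuous_map_compose[rotated])
  then show ?thesis
    by (rule continuous_map_eq) (use into assms(4) in \<open>auto simp: Pi_iff\<close>)
qed

context nonarch_field
begin

lemma topspace_berk_A1_top: "topspace (berk_A1_top absv) = berk_A1 absv"
proof -
  have "{\<zeta> \<in> berk_A1 absv. \<zeta> 0 \<in> UNIV} \<in> {{\<zeta> \<in> berk_A1 absv. \<zeta> p \<in> U} | p U. open U}"
    by blast
  then show ?thesis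
    by (auto simp: berk_A1_top_def)
qed

lemma continuous_map_berk_A1_eval: "continuous_map (berk_A1_top absv) euclideanreal (\<lambda>\<zeta>. \<zeta> p)"
  unfolding continuous_map_def topspace_berk_A1_top
proof (intro conjI allI impI)
  fix U :: "real set" assume "openin euclideanreal U"
  then have "openin (topology_generated_by {{\<zeta> \<in> berk_A1 absv. \<zeta> p \<in> U} | p U. open U})
      {\<zeta> \<in> berk_A1 absv. \<zeta> p \<in> U}"
    by (intro topology_generated_by_Basis) auto
  then show "openin (berk_A1_top absv) {\<zeta> \<in> berk_A1 absv. \<zeta> p \<in> U}"
    by (auto simp: berk_A1_top_def openin_subtopology)
qed simp

lemma continuous_map_euclidean_berk_A1_top:
  "continuous_map (top_of_set (berk_A1 absv)) (berk_A1_top absv) id"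
proof -
  let ?S = "{{\<zeta> \<in> berk_A1 absv. \<zeta> p \<in> U} | p U. open U}"
  have "continuous_map (top_of_set (berk_A1 absv)) (topology_generated_by ?S) id"
  proof (rule continuous_on_generated_topo)
    fix W assume "W \<in> ?S"
    then obtain p U where basic: "W = {\<zeta> \<in> berk_A1 absv. \<zeta> p \<in> U}" "open U"
      by blast
    have "open ((\<lambda>\<zeta>. \<zeta> p) -` U)"
      using basic(2) continuous_on_product_coordinates by (rule open_vimage)
    then have "openin (top_of_set (berk_A1 absv)) (berk_A1 absv \<inter> (\<lambda>\<zeta>. \<zeta> p) -` U)"
      by (rule openin_open_Int)
    also have "berk_A1 absv \<inter> (\<lambda>\<zeta>. \<zeta> p) -` U = id -` W \<inter> topspace (top_of_set (berk_A1 absv))"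
      by (auto simp: basic(1))
    finally show "openin (top_of_set (berk_A1 absv))
        (id -` W \<inter> topspace (top_of_set (berk_A1 absv)))" .
  next
    have "{\<zeta> \<in> berk_A1 absv. \<zeta> 0 \<in> UNIV} \<in> ?S"
      by blast
    then show "id ` topspace (top_of_set (berk_A1 absv)) \<subseteq> \<Union> ?S"
      by auto
  qed
  then show ?thesis
    by (simp add: berk_A1_top_def continuous_map_in_subtopology)
qed

lemma berk_A1_top_eq: "berk_A1_top absv = top_of_set (berk_A1 absv)"
proof -
  have "continuous_map (berk_A1_top absv) euclidean id"
    unfolding euclidean_product_topology[symmetric] continuous_map_componentwise_UNIV
    using continuous_map_berk_A1_eval by simp
  then have "continuous_map (berk_A1_top absv) (top_of_set (berk_A1 absv)) id"
    by (simp add: continuous_map_in_subtopology topspace_berk_A1_top)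
  with continuous_map_euclidean_berk_A1_top show ?thesis
    by (auto simp: topology_eq topspace_berk_A1_top simp flip: topology_finer_continuous_id)
qed

lemma closed_berk_A1: "closed (berk_A1 absv)"
  unfolding berk_A1_def
  by (intro closed_Collect_conj closed_Collect_all closed_Collect_le closed_Collect_eq
      continuous_intros continuous_on_product_coordinates)

lemma compactin_berk_A1_disc:
  "compactin (berk_A1_top absv) {\<zeta> \<in> berk_A1 absv. \<zeta> [:0, 1:] \<le> r}"
proof -
  let ?K = "{\<zeta> \<in> berk_A1 absv. \<zeta> [:0, 1:] \<le> r}"
  let ?B = "PiE UNIV (\<lambda>p. {0..gauss_norm r p})"
  have "compactin (product_topology (\<lambda>_. euclideanreal) UNIV) ?B"
    by (simp add: compactin_PiE)
  then have "compact ?B"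
    by (simp add: euclidean_product_topology)
  moreover have "closed ?K"
    unfolding Collect_conj_eq Collect_mem_eq
    by (intro closed_Int closed_berk_A1 closed_Collect_le continuous_on_const
        continuous_on_product_coordinates)
  ultimately have "compact (?K \<inter> ?B)"
    by (rule closed_Int_compact[rotated])
  moreover have "?K \<inter> ?B = ?K"
    using berk_A1_le_gauss_norm by (auto simp: berk_A1_nonneg)
  ultimately show ?thesis
    by (simp add: berk_A1_top_eq compactin_subtopology subset_iff)
qed

lemma Hausdorff_berk_A1_top: "Hausdorff_space (berk_A1_top absv)"
  unfolding berk_A1_top_eq
  by (intro Hausdorff_space_subtopology)
    (simp add: Hausdorff_space_product_topology flip: euclidean_product_topology)

lemma berk_P1_top_eq: "berk_P1_top absv = Alexandroff_compactification (berk_A1_top absv)"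
proof -
  have "{Some ` V | V. openin (berk_A1_top absv) V} \<union>
      {insert None (Some ` (berk_A1 absv - K)) | K. compactin (berk_A1_top absv) K}
      = {S. openin (Alexandroff_compactification (berk_A1_top absv)) S}"
    using compactin_imp_closedin[OF Hausdorff_berk_A1_top]
    by (auto simp: openin_Alexandroff_compactification topspace_berk_A1_top)
  moreover have "berk_P1 absv = topspace (Alexandroff_compactification (berk_A1_top absv))"
    by (simp add: berk_P1_def topspace_berk_A1_top)
  ultimately show ?thesis
    by (simp only: berk_P1_top_def topology_generated_by_openin subtopology_topspace)
qed

lemma topspace_berk_P1_top: "topspace (berk_P1_top absv) = berk_P1 absv"
  by (simp add: berk_P1_top_eq berk_P1_def topspace_berk_A1_top)

lemma openin_berk_P1_top_infinity:
  assumes "compactin (berk_A1_top absv) K"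
  shows "openin (berk_P1_top absv) (insert None (Some ` (berk_A1 absv - K)))"
proof -
  have "closedin (berk_A1_top absv) K"
    using Hausdorff_berk_A1_top assms by (rule compactin_imp_closedin)
  with assms show ?thesis
    unfolding berk_P1_top_eq openin_Alexandroff_compactification topspace_berk_A1_top by blast
qed

lemma continuous_map_coord_norm: "continuous_map (berk_A1_top absv) euclideanreal coord_norm"
  unfolding coord_norm_def[abs_def]
  by (intro continuous_map_real_max continuous_map_berk_A1_eval) simp

lemma berk_A1_abs_diff_le:
  assumes "\<zeta> \<in> berk_A1 absv"
  shows "\<bar>\<zeta> p - \<zeta> q\<bar> \<le> \<zeta> (p - q)"
  using berk_A1_add[OF assms, of "p - q" q] berk_A1_add[OF assms, of "q - p" p]
    berk_A1_smult[OF assms, of "-1" "p - q"] by simp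

lemma lin_norm_near_infinity:
  assumes point: "\<zeta> \<in> berk_A1 absv" and "1 \<le> r" "r < \<zeta> [:0, 1:]"
  shows "\<bar>lin_norm (Some \<zeta>) a b - absv b\<bar> \<le> absv a / r"
proof -
  define N where "N = \<zeta> [:0, 1:]"
  have N_eqs: "coord_norm \<zeta> = N" "0 < N" "r \<le> N"
    using assms by (simp_all add: coord_norm_def N_def)
  have "\<zeta> [:0, b:] = absv b * N"
    using berk_A1_smult[OF point, of b "[:0, 1:]"] by (simp add: N_def)
  then have "\<bar>\<zeta> (lin a b) - absv b * N\<bar> \<le> absv a"
    using berk_A1_abs_diff_le[OF point, of "lin a b" "[:0, b:]"]
    by (simp add: lin_def berk_A1_const[OF point])
  then have "\<bar>(\<zeta> (lin a b) - absv b * N) / N\<bar> \<le> absv a / N"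
    using N_eqs(2) by (simp add: abs_divide divide_right_mono)
  also have "(\<zeta> (lin a b) - absv b * N) / N = lin_norm (Some \<zeta>) a b - absv b"
    using N_eqs by (simp add: lin_norm_Some field_simps)
  also have "absv a / N \<le> absv a / r"
    using N_eqs assms(2) by (intro divide_left_mono) auto
  finally show ?thesis .
qed

lemma lin_norm_in_open_near_infinity:
  assumes "open W" "absv b \<in> W"
  obtains r where "\<And>\<zeta>. \<zeta> \<in> berk_A1 absv \<Longrightarrow> r < \<zeta> [:0, 1:] \<Longrightarrow> lin_norm (Some \<zeta>) a b \<in> W"
proof -
  obtain \<epsilon> where "0 < \<epsilon>" and ball: "\<And>x. \<bar>x - absv b\<bar> < \<epsilon> \<Longrightarrow> x \<in> W"
    using assms by (metis open_dist dist_real_def)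
  define r where "r = 1 + absv a / \<epsilon>"
  have "1 \<le> r" "absv a / r < \<epsilon>"
    using \<open>0 < \<epsilon>\<close> by (simp_all add: r_def add_pos_nonneg divide_less_eq field_simps)
  then have "\<bar>lin_norm (Some \<zeta>) a b - absv b\<bar> < \<epsilon>" if "\<zeta> \<in> berk_A1 absv" "r < \<zeta> [:0, 1:]" for \<zeta>
    using lin_norm_near_infinity[OF that(1) _ that(2)] by (meson le_less_trans)
  then show thesis
    using that ball by blast
qed

lemma openin_berk_A1_top_lin_norm:
  assumes "open W"
  shows "openin (berk_A1_top absv) {\<zeta> \<in> berk_A1 absv. lin_norm (Some \<zeta>) a b \<in> W}"
proof -
  have "continuous_map (berk_A1_top absv) euclideanreal (\<lambda>\<zeta>. \<zeta> (lin a b) / coord_norm \<zeta>)"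
    by (intro continuous_map_real_divide continuous_map_coord_norm continuous_map_berk_A1_eval) simp
  then show ?thesis
    unfolding lin_norm_Some topspace_berk_A1_top[symmetric]
    by (rule openin_continuous_map_preimage) (use assms in simp)
qed

lemma continuous_map_lin_norm:
  "continuous_map (berk_P1_top absv) euclideanreal (\<lambda>z. lin_norm z a b)"
  unfolding continuous_map_def topspace_berk_P1_top
proof (intro conjI allI impI)
  fix W :: "real set" assume "openin euclideanreal W"
  then have "open W"
    by simp
  define V where "V = {\<zeta> \<in> berk_A1 absv. lin_norm (Some \<zeta>) a b \<in> W}"
  have V_open: "openin (berk_P1_top absv) (Some ` V)"
    using openin_berk_A1_top_lin_norm[OF \<open>open W\<close>] by (simp add: berk_P1_top_eq V_def)
  have preimage: "{z \<in> berk_P1 absv. lin_norm z a b \<in> W}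
      = Some ` V \<union> (if absv b \<in> W then {None} else {})"
    by (auto simp: V_def berk_P1_def)
  show "openin (berk_P1_top absv) {z \<in> berk_P1 absv. lin_norm z a b \<in> W}"
  proof (cases "absv b \<in> W")
    case False
    then show ?thesis
      unfolding preimage using V_open by simp
  next
    case True
    obtain r where near: "\<And>\<zeta>. \<zeta> \<in> berk_A1 absv \<Longrightarrow> r < \<zeta> [:0, 1:] \<Longrightarrow> lin_norm (Some \<zeta>) a b \<in> W"
      using lin_norm_in_open_near_infinity[OF \<open>open W\<close> True] by blast
    let ?outside = "berk_A1 absv - {\<zeta> \<in> berk_A1 absv. \<zeta> [:0, 1:] \<le> r}"
    have "?outside \<subseteq> V"
      using near by (auto simp: V_def)
    then have "{z \<in> berk_P1 absv. lin_norm z a b \<in> W} = Some ` V \<union> insert None (Some ` ?outside)"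
      unfolding preimage if_P[OF True] by blast
    moreover have "openin (berk_P1_top absv) (insert None (Some ` ?outside))"
      by (rule openin_berk_P1_top_infinity[OF compactin_berk_A1_disc])
    ultimately show ?thesis
      using openin_Un[OF V_open] by (simp only:)
  qed
qed simp

end

context alg_closed_nonarch_field
begin

text \<open>The values on linear forms embed the compact space \<open>\<P>\<^sup>1_an\<close> into a product of lines.\<close>
lemma continuous_map_into_berk_P1_top:
  assumes into: "h \<in> topspace X \<rightarrow> berk_P1 absv"
    and "\<And>a b. unimodular a b \<Longrightarrow> continuous_map X euclideanreal (\<lambda>x. lin_norm (h x) a b)"
  shows "continuous_map X (berk_P1_top absv) h"
proof -
  define I where "I = {(a, b). unimodular a b}"
  define coords where "coords z = (\<lambda>(a, b)\<in>I. lin_norm z a b)" for z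
  let ?T = "product_topology (\<lambda>_. euclideanreal) I"
  have "inj_on coords (berk_P1 absv)"
  proof (rule inj_onI)
    fix z z' assume points: "z \<in> berk_P1 absv" "z' \<in> berk_P1 absv"
      and coords_eq: "coords z = coords z'"
    show "z = z'"
    proof (rule berk_P1_eqI[OF points])
      fix a b assume "unimodular a b"
      then show "lin_norm z a b = lin_norm z' a b"
        using fun_cong[OF coords_eq, of "(a, b)"] by (simp add: coords_def I_def)
    qed
  qed
  moreover have "continuous_map (berk_P1_top absv) ?T coords"
    by (auto simp: continuous_map_componentwise coords_def continuous_map_lin_norm)
  moreover have "continuous_map X ?T (coords \<circ> h)"
    using assms(2) by (auto simp: continuous_map_componentwise coords_def I_def)
  moreover have "compact_space (berk_P1_top absv)" "Hausdorff_space ?T"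
    by (simp_all add: berk_P1_top_eq Hausdorff_space_product_topology)
  ultimately show ?thesis
    using into
    by (intro continuous_map_if_injection_compose[of _ ?T coords])
      (simp_all add: topspace_berk_P1_top)
qed

end

section \<open>Maps of good reduction\<close>

lemma hom_comp_const: "hom_comp [:c:] f g = [:c:]"
  by (simp add: hom_comp_def)

lemma hom_comp_lin_mult:
  assumes "q \<noteq> 0"
  shows "hom_comp (lin c 1 * q) f g = (f - smult c g) * hom_comp q f g"
proof -
  define n where "n = degree q"
  have degree: "degree (lin c 1 * q) = Suc n"
    using assms by (subst degree_mult_eq) (auto simp: lin_def n_def)
  have coeffs: "lin c 1 * q = pCons 0 q - smult c q"
    by (simp add: lin_def)
  have "hom_comp (lin c 1 * q) f g
      = (\<Sum>i\<le>Suc n. smult (coeff (pCons 0 q) i) (f ^ i * g ^ (Suc n - i)))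
        - (\<Sum>i\<le>Suc n. smult c (smult (coeff q i) (f ^ i * g ^ (Suc n - i))))"
    unfolding hom_comp_def degree sum_subtractf[symmetric]
    by (rule sum.cong) (simp_all add: coeffs smult_diff_left)
  also have "(\<Sum>i\<le>Suc n. smult (coeff (pCons 0 q) i) (f ^ i * g ^ (Suc n - i))) = f * hom_comp q f g"
    by (simp add: sum.atMost_Suc_shift hom_comp_def n_def sum_distrib_left mult_ac
        del: sum.atMost_Suc)
  also have "(\<Sum>i\<le>Suc n. smult c (smult (coeff q i) (f ^ i * g ^ (Suc n - i))))
      = (\<Sum>i\<le>n. smult c g * smult (coeff q i) (f ^ i * g ^ (n - i)))"
    by (simp add: coeff_eq_0 n_def Suc_diff_le mult_ac)
  also have "\<dots> = smult c g * hom_comp q f g"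
    by (simp add: hom_comp_def n_def sum_distrib_left)
  finally show ?thesis
    by (simp add: left_diff_distrib)
qed

lemma hom_comp_lin: "hom_comp (lin c 1) f g = f - smult c g"
  using hom_comp_lin_mult[of 1 c f g] hom_comp_const[of 1 f g] by (simp add: one_pCons)

context nonarch_field
begin

lemma berk_A1_pencil_iff:
  assumes point: "\<zeta> \<in> berk_A1 absv"
  shows "(\<forall>c. \<zeta> (f - smult c g) = \<zeta> (lin c 1) * \<zeta> g)
    \<longleftrightarrow> (\<forall>a b. \<zeta> (pencil a b f g) = \<zeta> (lin a b) * \<zeta> g)"
proof (intro iffI allI)
  fix a b assume monic: "\<forall>c. \<zeta> (f - smult c g) = \<zeta> (lin c 1) * \<zeta> g"
  show "\<zeta> (pencil a b f g) = \<zeta> (lin a b) * \<zeta> g"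
  proof (cases "b = 0")
    case True
    then have "pencil a b f g = lin a b * g"
      by (simp add: pencil_def lin_def)
    then show ?thesis
      by (simp add: berk_A1_mult[OF point])
  next
    case False
    then have "pencil a b f g = smult b (f - smult (a / b) g)" "lin a b = smult b (lin (a / b) 1)"
      by (simp_all add: pencil_def lin_def smult_diff_right)
    with monic show ?thesis
      by (simp add: berk_A1_smult[OF point])
  qed
next
  fix c assume "\<forall>a b. \<zeta> (pencil a b f g) = \<zeta> (lin a b) * \<zeta> g"
  then have "\<zeta> (pencil c 1 f g) = \<zeta> (lin c 1) * \<zeta> g"
    by blast
  then show "\<zeta> (f - smult c g) = \<zeta> (lin c 1) * \<zeta> g"
    by (simp add: pencil_def)
qed

end

context alg_closed_nonarch_field
begin

lemma berk_A1_hom_comp: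
  assumes point: "\<zeta> \<in> berk_A1 absv"
    and monic: "\<And>c. \<zeta> (f - smult c g) = \<zeta> (lin c 1) * \<zeta> g"
  shows "\<zeta> (hom_comp p f g) = \<zeta> p * \<zeta> g ^ degree p"
proof (induction "degree p" arbitrary: p)
  case 0
  then obtain c where "p = [:c:]"
    by (metis degree_eq_zeroE)
  then show ?case
    by (simp add: hom_comp_const)
next
  case (Suc n)
  obtain c q where factor: "p = lin c 1 * q" "degree q = n" "q \<noteq> 0"
    using monic_linear_factor Suc.hyps(2)[symmetric] .
  have "\<zeta> (hom_comp p f g) = \<zeta> (lin c 1) * \<zeta> g * (\<zeta> q * \<zeta> g ^ n)"
    using factor by (simp add: hom_comp_lin_mult berk_A1_mult[OF point] monic Suc.hyps(1))
  then show ?case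
    using Suc.hyps(2)[symmetric] by (simp add: factor(1) berk_A1_mult[OF point])
qed

lemma berk_map_Some_fixed_iff:
  assumes point: "\<zeta> \<in> berk_A1 absv"
  shows "berk_map absv f g (Some \<zeta>) = Some \<zeta>
    \<longleftrightarrow> \<zeta> g \<noteq> 0 \<and> (\<forall>a b. \<zeta> (pencil a b f g) = \<zeta> (lin a b) * \<zeta> g)"
proof -
  have "(\<lambda>p. \<zeta> (hom_comp p f g) / \<zeta> g ^ degree p) = \<zeta>
      \<longleftrightarrow> (\<forall>c. \<zeta> (f - smult c g) = \<zeta> (lin c 1) * \<zeta> g)" if "\<zeta> g \<noteq> 0"
  proof
    assume "(\<lambda>p. \<zeta> (hom_comp p f g) / \<zeta> g ^ degree p) = \<zeta>"
    then have "\<zeta> (hom_comp (lin c 1) f g) / \<zeta> g ^ degree (lin c 1) = \<zeta> (lin c 1)" for c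
      by metis
    moreover have "degree (lin c 1) = 1" for c :: 'a
      by (simp add: lin_def)
    ultimately show "\<forall>c. \<zeta> (f - smult c g) = \<zeta> (lin c 1) * \<zeta> g"
      using that by (simp add: hom_comp_lin field_simps)
  next
    assume "\<forall>c. \<zeta> (f - smult c g) = \<zeta> (lin c 1) * \<zeta> g"
    with that show "(\<lambda>p. \<zeta> (hom_comp p f g) / \<zeta> g ^ degree p) = \<zeta>"
      by (simp add: berk_A1_hom_comp[OF point])
  qed
  then show ?thesis
    by (auto simp: berk_map_def berk_A1_pencil_iff[OF point])
qed

end

locale good_reduction_map = alg_closed_nonarch_field absv for absv :: "'a::field \<Rightarrow> real" +
  fixes f g :: "'a poly"
  assumes rat_deg_ge_2: "2 \<le> rat_deg f g"
    and normalized: "normalized absv f g"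
    and good: "good_reduction absv f g"
begin

abbreviation d :: nat where
  "d \<equiv> rat_deg f g"

lemma degree_f: "degree f \<le> d" and degree_g: "degree g \<le> d"
  by (simp_all add: rat_deg_def)

lemma gauss_f_le: "gauss f \<le> 1" and gauss_g_le: "gauss g \<le> 1"
  using normalized by (auto simp: normalized_def integral_poly_iff)

lemma gauss_f_or_g: "gauss f = 1 \<or> gauss g = 1"
  using normalized by (auto simp: normalized_def gauss_eq_1_iff)

lemma degree_pencil_f_g: "degree (pencil a b f g) \<le> d"
  by (intro degree_pencil degree_f degree_g)

lemma red_deg_eq: "red_deg absv f g = d"
  using good by (simp add: good_reduction_def)

lemma no_common_factor:
  assumes "gauss h \<le> 1" "degree h \<le> k" "red_form_dvd absv k h d f" "red_form_dvd absv k h d g"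
  shows "k = 0"
proof -
  have "gauss h = 1"
    using gauss_f_or_g red_form_dvd_gauss_eq_1 assms(1,3,4) by blast
  define common where "common k \<longleftrightarrow> k \<le> d \<and>
     (\<exists>h. integral_poly absv h \<and> nonzero_red absv h \<and> degree h \<le> k \<and>
          red_form_dvd absv k h d f \<and> red_form_dvd absv k h d g)" for k
  have "k \<le> d"
    using assms(3) by (rule red_form_dvdE)
  with assms \<open>gauss h = 1\<close> have "common k"
    unfolding common_def gauss_eq_1_iff by blast
  then have "k \<le> red_common_deg absv f g"
    unfolding red_common_deg_def common_def[symmetric]
    by (rule Greatest_le_nat[where b = d]) (simp add: common_def)
  then show ?thesis
    using red_deg_eq rat_deg_ge_2 by (simp add: red_deg_def)
qed

lemma unimodular_hom_eval:
  assumes unimod: "unimodular a b"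
  shows "unimodular (hom_eval d f a b) (hom_eval d g a b)"
proof (rule ccontr)
  assume "\<not> ?thesis"
  moreover have "absv (hom_eval d f a b) \<le> 1" "absv (hom_eval d g a b) \<le> 1"
    using absv_hom_eval_le_gauss[OF unimod] gauss_f_le gauss_g_le by (meson order_trans)+
  ultimately have "absv (hom_eval d f a b) < 1" "absv (hom_eval d g a b) < 1"
    unfolding unimodular_def by linarith+
  moreover have "0 < d"
    using rat_deg_ge_2 by linarith
  ultimately have "red_form_dvd absv 1 (lin a b) d f" "red_form_dvd absv 1 (lin a b) d g"
    using red_form_dvd_lin[OF degree_f _ unimod gauss_f_le]
      red_form_dvd_lin[OF degree_g _ unimod gauss_g_le] by blast+
  then show False
    using no_common_factor[OF _ degree_lin] gauss_lin_unimodular[OF unimod] by fastforce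
qed

lemma not_cong_m_smult:
  assumes "absv u \<le> 1"
  shows "\<not> cong_m absv f (smult u g)" "\<not> cong_m absv g (smult u f)"
proof -
  have "\<not> red_form_dvd absv d g d f" "\<not> red_form_dvd absv d f d g"
    using no_common_factor[OF gauss_f_le degree_f red_form_dvd_refl] rat_deg_ge_2
      no_common_factor[OF gauss_g_le degree_g _ red_form_dvd_refl] by auto
  moreover have "red_form_dvd absv d g d (smult u g)" "red_form_dvd absv d f d (smult u f)"
    using assms gauss_f_le gauss_g_le by (simp_all add: red_form_dvd_smult red_form_dvd_refl)
  ultimately show "\<not> cong_m absv f (smult u g)" "\<not> cong_m absv g (smult u f)"
    using red_form_dvd_cong by blast+
qed

lemma gauss_pencil:
  assumes unimod: "unimodular a b"
  shows "gauss (pencil a b f g) = 1"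
proof (rule ccontr)
  assume "gauss (pencil a b f g) \<noteq> 1"
  moreover have "gauss (pencil a b f g) \<le> 1"
    using gauss_pencil_le[OF gauss_f_le gauss_g_le] unimod by (metis unimodular_def)
  ultimately have small: "gauss (pencil a b f g) < 1"
    by simp
  from unimod show False
  proof (cases rule: unimodular_cases)
    case first
    then have "a \<noteq> 0"
      by auto
    then have "g - smult (b / a) f = smult (- 1 / a) (pencil a b f g)"
      by (simp add: pencil_def smult_diff_right)
    with small first have "cong_m absv g (smult (b / a) f)"
      by (simp add: cong_m_iff gauss_smult absv_divide)
    then show False
      using not_cong_m_smult(2) first unimodular_le_1[OF unimod] by (simp add: absv_divide)
  next
    case second
    then have "b \<noteq> 0"
      by auto
    then have "f - smult (a / b) g = smult (1 / b) (pencil a b f g)"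
      by (simp add: pencil_def smult_diff_right)
    with small second have "cong_m absv f (smult (a / b) g)"
      by (simp add: cong_m_iff gauss_smult absv_divide)
    then show False
      using not_cong_m_smult(1) second unimodular_le_1[OF unimod] by (simp add: absv_divide)
  qed
qed

lemma max_form_norm_f_g:
  assumes point: "z \<in> berk_P1 absv"
  shows "max (form_norm z d f) (form_norm z d g) = 1"
proof -
  have "form_norm z d f = 1 \<or> form_norm z d g = 1"
  proof (cases "\<exists>a b. unimodular a b \<and> lin_norm z a b < 1")
    case True
    then obtain a b where "unimodular a b" and near: "lin_norm z a b < 1"
      by blast
    then have "absv (hom_eval d f a b) = 1 \<or> absv (hom_eval d g a b) = 1"
      using unimodular_cases unimodular_hom_eval by metis
    then show ?thesis
      using form_norm_eq_1_if_hom_eval_unit[OF _ point \<open>unimodular a b\<close> near]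
        degree_f degree_g gauss_f_le gauss_g_le
      by blast
  next
    case False
    then have "z = Some gauss"
      using lin_norm_le_1[OF point]
      by (intro berk_P1_eqI point gauss_in_berk_P1) (force simp: lin_norm_gauss)
    then show ?thesis
      using gauss_f_or_g by (simp add: form_norm_gauss)
  qed
  then show ?thesis
    using form_norm_le_gauss[OF point degree_f] form_norm_le_gauss[OF point degree_g]
      gauss_f_le gauss_g_le by auto
qed

definition forms_invariant :: "('a poly \<Rightarrow> real) option \<Rightarrow> bool" where
  "forms_invariant z \<longleftrightarrow>
    (\<forall>a b. unimodular a b \<longrightarrow> form_norm z d (pencil a b f g) = lin_norm z a b)"

lemma forms_invariantD:
  assumes "forms_invariant z" and point: "z \<in> berk_P1 absv"
  shows "form_norm z d (pencil a b f g) = lin_norm z a b"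
proof (cases "a = 0 \<and> b = 0")
  case True
  then show ?thesis
    using form_norm_smult[OF point, of d 0 0] lin_norm_mult_left[OF point, of 0 a b]
    by (simp add: pencil_def)
next
  case False
  then obtain k a' b' where "a = k * a'" "b = k * b'" "unimodular a' b'"
    using unimodular_scaling by metis
  with assms show ?thesis
    by (simp add: forms_invariant_def pencil_mult_left form_norm_smult lin_norm_mult_left)
qed

lemma berk_map_None_fixed_iff: "berk_map absv f g None = None \<longleftrightarrow> forms_invariant None"
proof -
  have "degree g < degree f \<longleftrightarrow> coeff g d = 0"
  proof
    assume "degree g < degree f"
    then show "coeff g d = 0"
      by (simp add: rat_deg_def coeff_eq_0)
  next
    assume "coeff g d = 0"
    then have "degree g \<noteq> d"
      using rat_deg_ge_2 by (metis degree_0 leading_coeff_0_iff not_numeral_le_zero)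
    then show "degree g < degree f"
      by (auto simp: rat_deg_def max_def split: if_splits)
  qed
  also have "\<dots> \<longleftrightarrow> forms_invariant None"
  proof
    assume "coeff g d = 0"
    moreover from this have "absv (coeff f d) = 1"
      using max_form_norm_f_g[of None] absv_nonneg[of "coeff f d"]
      by (simp add: berk_P1_def max_def split: if_splits)
    ultimately show "forms_invariant None"
      by (simp add: forms_invariant_def pencil_def absv_mult)
  next
    assume "forms_invariant None"
    then show "coeff g d = 0"
      using forms_invariantD[of None 1 0] by (simp add: berk_P1_def pencil_def)
  qed
  finally show ?thesis
    by (simp add: berk_map_def)
qed

lemma coord_norm_mult_value_g:
  assumes point: "\<zeta> \<in> berk_A1 absv"
    and pencil: "\<And>a b. \<zeta> (pencil a b f g) = \<zeta> (lin a b) * \<zeta> g"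
  shows "coord_norm \<zeta> * \<zeta> g = coord_norm \<zeta> ^ d"
proof -
  have "max (\<zeta> f) (\<zeta> g) / coord_norm \<zeta> ^ d = max (form_norm (Some \<zeta>) d f) (form_norm (Some \<zeta>) d g)"
    by (simp add: form_norm_Some max_divide_distrib_right)
  also have "\<dots> = 1"
    using point by (intro max_form_norm_f_g) (simp add: berk_P1_def)
  finally have "max (\<zeta> f) (\<zeta> g) = coord_norm \<zeta> ^ d"
    by simp
  moreover have "\<zeta> f = \<zeta> [:0, 1:] * \<zeta> g"
    using pencil[of 0 1] by (simp add: pencil_def lin_def)
  ultimately show ?thesis
    using berk_A1_nonneg[OF point, of g]
    by (simp add: coord_norm_def max_mult_distrib_right max.commute)
qed

lemma berk_map_Some_fixed_iff_forms_invariant: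
  assumes point: "\<zeta> \<in> berk_A1 absv"
  shows "berk_map absv f g (Some \<zeta>) = Some \<zeta> \<longleftrightarrow> forms_invariant (Some \<zeta>)"
proof -
  have P1_point: "Some \<zeta> \<in> berk_P1 absv"
    using point by (simp add: berk_P1_def)
  define N where "N = coord_norm \<zeta>"
  have "0 < N"
    by (simp add: N_def)
  have norms: "form_norm (Some \<zeta>) n p = \<zeta> p / N ^ n"
    "lin_norm (Some \<zeta>) a b = \<zeta> (lin a b) / N" for n p a b
    by (simp_all add: form_norm_Some lin_norm_Some N_def)
  show ?thesis
  proof
    assume "berk_map absv f g (Some \<zeta>) = Some \<zeta>"
    then have pencil: "\<zeta> (pencil a b f g) = \<zeta> (lin a b) * \<zeta> g" for a b
      using berk_map_Some_fixed_iff[OF point] by simp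
    then have "N * \<zeta> g = N ^ d"
      unfolding N_def by (rule coord_norm_mult_value_g[OF point])
    then show "forms_invariant (Some \<zeta>)"
      using \<open>0 < N\<close> by (simp add: forms_invariant_def norms pencil field_simps)
  next
    assume invariant: "forms_invariant (Some \<zeta>)"
    have "\<zeta> g / N ^ d = 1 / N"
      using forms_invariantD[OF invariant P1_point, of "-1" 0] berk_A1_const[OF point, of 1]
      by (simp add: norms pencil_def lin_def)
    then have value_g: "\<zeta> g = N ^ d / N"
      using \<open>0 < N\<close> by (simp add: field_simps)
    have "\<zeta> (pencil a b f g) = \<zeta> (lin a b) * \<zeta> g" for a b
      using forms_invariantD[OF invariant P1_point, of a b] \<open>0 < N\<close>
      by (simp add: norms value_g field_simps)
    then show "berk_map absv f g (Some \<zeta>) = Some \<zeta>"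
      using \<open>0 < N\<close> by (simp add: berk_map_Some_fixed_iff[OF point] value_g)
  qed
qed

lemma fixed_locus_iff: "z \<in> berk_fixed_locus absv f g \<longleftrightarrow> z \<in> berk_P1 absv \<and> forms_invariant z"
  using berk_map_None_fixed_iff berk_map_Some_fixed_iff_forms_invariant
  by (auto simp: berk_fixed_locus_def berk_P1_def)

lemma gauss_point_fixed: "Some gauss \<in> berk_fixed_locus absv f g"
  by (simp add: fixed_locus_iff gauss_in_berk_P1 forms_invariant_def form_norm_gauss lin_norm_gauss
      gauss_pencil)

lemma red_has_fixed_critD:
  assumes "red_has_fixed_crit absv f g"
  obtains a b where "unimodular a b" "red_form_dvd absv 2 (lin a b ^ 2) d (pencil a b f g)"
proof -
  obtain h f' g' a b where content: "integral_poly absv h" "nonzero_red absv h" "degree h \<le> d - d"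
    and integral: "integral_poly absv f'" "integral_poly absv g'"
    and factor: "cong_m absv f (h * f')" "cong_m absv g (h * g')"
    and unimod: "unimodular a b" and crit: "red_fixed_critical absv d f' g' a b"
    using assms unfolding red_has_fixed_crit_def red_deg_eq Let_def unimodular_def by blast
  obtain k where const: "h = [:k:]"
    using content(3) by (metis degree_eq_zeroE diff_self_eq_0 le_zero_eq)
  have "absv k = 1"
    using content gauss_eq_1_iff[of h] by (simp add: const)
  have le_1: "gauss f' \<le> 1" "gauss g' \<le> 1"
    using integral by (simp_all add: integral_poly_iff)
  have "red_form_dvd absv 2 (lin a b ^ 2) d (pencil a b f' g')"
    using crit red_fixed_critical_iff[OF unimod le_1 rat_deg_ge_2] by blast
  moreover have "gauss (pencil a b f' g') \<le> 1" "gauss (lin a b ^ 2) \<le> 1"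
    using gauss_pencil_le[OF le_1, of a b] unimod
    by (simp_all add: unimodular_def power2_eq_square gauss_mult gauss_lin)
  ultimately have "red_form_dvd absv 2 (lin a b ^ 2) d (smult k (pencil a b f' g'))"
    using \<open>absv k = 1\<close> by (intro red_form_dvd_smult) simp_all
  moreover have "cong_m absv (pencil a b f g) (pencil a b (smult k f') (smult k g'))"
    using factor unimodular_le_1[OF unimod] le_1 \<open>absv k = 1\<close>
    by (intro cong_m_pencil) (simp_all add: const gauss_smult)
  ultimately have "red_form_dvd absv 2 (lin a b ^ 2) d (pencil a b f g)"
    by (simp add: red_form_dvd_cong pencil_def smult_diff_right mult.commute)
  with unimod show thesis
    by (rule that)
qed

lemma red_has_fixed_critI:
  assumes unimod: "unimodular a b" and "red_form_dvd absv 2 (lin a b ^ 2) d (pencil a b f g)"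
  shows "red_has_fixed_crit absv f g"
proof -
  have "red_fixed_critical absv d f g a b"
    using red_fixed_critical_iff[OF unimod gauss_f_le gauss_g_le rat_deg_ge_2]
      unimodular_hom_eval[OF unimod] assms(2) by blast
  moreover have "integral_poly absv 1" "nonzero_red absv 1"
    using gauss_eq_1_iff[of 1] by (simp_all add: one_pCons)
  moreover have "integral_poly absv f" "integral_poly absv g"
    using gauss_f_le gauss_g_le by (simp_all add: integral_poly_iff)
  moreover have "cong_m absv f (1 * f)" "cong_m absv g (1 * g)"
    by simp_all
  ultimately show ?thesis
    unfolding red_has_fixed_crit_def red_deg_eq Let_def
    using unimod unimodular_le_1[OF unimod] degree_f degree_g
    by (metis degree_1 le0 unimodular_def)
qed

end

section \<open>Paths to the Gauss point\<close>

context nonarch_field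
begin

lemma path_point_exists:
  assumes point: "z \<in> berk_P1 absv" and parameter: "0 \<le> t" "t \<le> 1"
  shows "\<exists>z' \<in> berk_P1 absv. \<forall>a b. unimodular a b \<longrightarrow> lin_norm z' a b = max (lin_norm z a b) t"
proof (cases "\<exists>c e. unimodular c e \<and> lin_norm z c e < t")
  case True
  then obtain c e where "unimodular c e" "lin_norm z c e < t"
    by blast
  then show ?thesis
    using parameter lin_norm_chordal_disc[OF parameter] max_lin_norm_eq_max_chordal[OF point]
    by (intro bexI[of _ "chordal_disc c e t"]) (auto simp: chordal_disc_in_berk_P1)
next
  case False
  then show ?thesis
    using point by (intro bexI[of _ z]) (auto simp: not_less intro: max.absorb1[symmetric])
qed

definition path_point :: "('a poly \<Rightarrow> real) option \<Rightarrow> real \<Rightarrow> ('a poly \<Rightarrow> real) option" where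
  "path_point z t = (SOME z'. z' \<in> berk_P1 absv \<and>
    (\<forall>a b. unimodular a b \<longrightarrow> lin_norm z' a b = max (lin_norm z a b) t))"

lemma
  assumes "z \<in> berk_P1 absv" "0 \<le> t" "t \<le> 1"
  shows path_point_in_berk_P1: "path_point z t \<in> berk_P1 absv"
    and lin_norm_path_point:
      "unimodular a b \<Longrightarrow> lin_norm (path_point z t) a b = max (lin_norm z a b) t"
  using someI_ex[OF path_point_exists[OF assms, unfolded Bex_def]]
  unfolding path_point_def[symmetric] by blast+

end

context alg_closed_nonarch_field
begin

lemma path_point_0:
  assumes "z \<in> berk_P1 absv"
  shows "path_point z 0 = z"
  by (rule berk_P1_eqI)
    (use assms in \<open>simp_all add: path_point_in_berk_P1 lin_norm_path_point lin_norm_nonneg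
      max_absorb1\<close>)

lemma path_point_1:
  assumes "z \<in> berk_P1 absv"
  shows "path_point z 1 = Some gauss"
  by (rule berk_P1_eqI)
    (use assms in \<open>simp_all add: path_point_in_berk_P1 lin_norm_path_point gauss_in_berk_P1
      lin_norm_gauss lin_norm_le_1 max_absorb2\<close>)

lemma continuous_map_path_point:
  assumes "z \<in> berk_P1 absv"
  shows "continuous_map (top_of_set {0..1}) (berk_P1_top absv) (path_point z)"
proof (rule continuous_map_into_berk_P1_top)
  show "path_point z \<in> topspace (top_of_set {0..1}) \<rightarrow> berk_P1 absv"
    using path_point_in_berk_P1[OF assms] by auto
next
  fix a b assume "unimodular a b"
  have "continuous_on {0..1} (\<lambda>t. max (lin_norm z a b) t)"
    by (intro continuous_intros)
  then have "continuous_on {0..1} (\<lambda>t. lin_norm (path_point z t) a b)"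
    by (rule continuous_on_eq) (use assms \<open>unimodular a b\<close> in \<open>simp add: lin_norm_path_point\<close>)
  then show "continuous_map (top_of_set {0..1}) euclideanreal (\<lambda>t. lin_norm (path_point z t) a b)"
    by simp
qed

lemma form_norm_path_point_eq_1:
  assumes point: "z \<in> berk_P1 absv" and parameter: "0 \<le> t" "t \<le> 1"
    and form: "degree p \<le> n" "gauss p \<le> 1" "form_norm z n p = 1"
  shows "form_norm (path_point z t) n p = 1"
proof -
  have "form_norm z n p \<le> form_norm (path_point z t) n p"
    using point parameter
    by (intro form_norm_mono form) (simp_all add: path_point_in_berk_P1 lin_norm_path_point)
  moreover have "form_norm (path_point z t) n p \<le> 1"
    using form_norm_le_gauss[OF path_point_in_berk_P1[OF point parameter] form(1)] form(2) by simp
  ultimately show ?thesis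
    using form(3) by simp
qed

end

section \<open>Connectedness of the fixed locus without critical fixed points\<close>

context good_reduction_map
begin

lemma absv_hom_eval_pencil_less_1:
  assumes fixed: "z \<in> berk_fixed_locus absv f g" and unimod: "unimodular a b"
    and near: "lin_norm z a b < 1"
  shows "absv (hom_eval d (pencil a b f g) a b) < 1"
proof (rule ccontr)
  assume "\<not> ?thesis"
  moreover have "absv (hom_eval d (pencil a b f g) a b) \<le> 1"
    using absv_hom_eval_le_gauss[OF unimod, of d "pencil a b f g"] gauss_pencil[OF unimod] by simp
  ultimately have "form_norm z d (pencil a b f g) = 1"
    using fixed form_norm_eq_1_if_hom_eval_unit[OF degree_pencil_f_g _ unimod near]
      gauss_pencil[OF unimod]
    by (simp add: fixed_locus_iff)
  then show False
    using fixed unimod near by (simp add: fixed_locus_iff forms_invariant_def)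
qed

lemma simple_factor_at_reduced_fixed_point:
  assumes noncrit: "\<not> red_has_fixed_crit absv f g" and unimod: "unimodular a b"
    and small: "absv (hom_eval d (pencil a b f g) a b) < 1"
  obtains n c e q where "d = Suc n" "degree q \<le> n" "gauss q = 1" "unimodular c e"
    "pencil a b f g = lin c e * q" "absv (hom_eval n q a b) = 1"
proof -
  obtain n c e q where factor: "d = Suc n" "degree q \<le> n" "gauss q = 1" "unimodular c e"
    "chordal a b c e < 1" "pencil a b f g = lin c e * q"
    using form_factor_near_zero[OF degree_pencil_f_g unimod gauss_pencil[OF unimod] small] .
  have "0 < n"
    using factor(1) rat_deg_ge_2 by linarith
  have "1 \<le> absv (hom_eval n q a b)"
  proof (rule ccontr)
    assume "\<not> ?thesis"
    then have "red_form_dvd absv 1 (lin a b) n q"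
      using factor(3) by (intro red_form_dvd_lin factor(2) \<open>0 < n\<close> unimod) simp_all
    moreover have "absv (hom_eval 1 (lin c e) a b) < 1"
      using hom_eval_lin_mult[of 1 0 c e a b] factor(5) chordal_commute[of a b c e]
      by (simp add: hom_eval_def chordal_def)
    then have "red_form_dvd absv 1 (lin a b) 1 (lin c e)"
      using factor(4)
      by (intro red_form_dvd_lin degree_lin unimod) (simp_all add: gauss_lin_unimodular)
    ultimately have "red_form_dvd absv (1 + 1) (lin a b * lin a b) (1 + n) (lin c e * q)"
      using unimod factor(4) by (intro red_form_dvd_mult) (simp_all add: gauss_lin_unimodular)
    then have "red_form_dvd absv 2 (lin a b ^ 2) d (pencil a b f g)"
      by (simp add: factor(1,6) power2_eq_square numeral_2_eq_2)
    with noncrit unimod show False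
      using red_has_fixed_critI by blast
  qed
  moreover have "absv (hom_eval n q a b) \<le> 1"
    using absv_hom_eval_le_gauss[OF unimod, of n q] factor(3) by simp
  ultimately show thesis
    using that factor by simp
qed

lemma form_norm_pencil_path_point:
  assumes noncrit: "\<not> red_has_fixed_crit absv f g"
    and fixed: "z \<in> berk_fixed_locus absv f g" and parameter: "0 \<le> t" "t \<le> 1"
    and unimod: "unimodular a b" and near: "lin_norm z a b < 1"
  shows "form_norm (path_point z t) d (pencil a b f g) = lin_norm (path_point z t) a b"
proof -
  have point: "z \<in> berk_P1 absv"
    and invariant: "form_norm z d (pencil a b f g) = lin_norm z a b"
    using fixed unimod by (simp_all add: fixed_locus_iff forms_invariant_def)
  have "absv (hom_eval d (pencil a b f g) a b) < 1"
    using absv_hom_eval_pencil_less_1[OF fixed unimod near] .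
  then obtain n c e q where cofactor: "d = Suc n" "degree q \<le> n" "gauss q = 1"
    and unimod': "unimodular c e" and factor: "pencil a b f g = lin c e * q"
    and unit: "absv (hom_eval n q a b) = 1"
    by (rule simple_factor_at_reduced_fixed_point[OF noncrit unimod])
  have norm_q: "form_norm z n q = 1"
    using cofactor unit by (intro form_norm_eq_1_if_hom_eval_unit[OF _ point unimod near]) simp_all
  then have "lin_norm z c e = lin_norm z a b"
    using invariant cofactor point by (simp add: factor form_norm_lin_mult)
  moreover have "form_norm (path_point z t) n q = 1"
    using cofactor norm_q by (intro form_norm_path_point_eq_1 point parameter) simp_all
  ultimately show ?thesis
    using cofactor path_point_in_berk_P1[OF point parameter]
      lin_norm_path_point[OF point parameter] unimod unimod'
    by (simp add: factor form_norm_lin_mult)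
qed

lemma path_point_fixed:
  assumes noncrit: "\<not> red_has_fixed_crit absv f g"
    and fixed: "z \<in> berk_fixed_locus absv f g" and parameter: "0 \<le> t" "t \<le> 1"
  shows "path_point z t \<in> berk_fixed_locus absv f g"
proof -
  have point: "z \<in> berk_P1 absv" and invariant: "forms_invariant z"
    using fixed by (simp_all add: fixed_locus_iff)
  have "form_norm (path_point z t) d (pencil a b f g) = lin_norm (path_point z t) a b"
    if unimod: "unimodular a b" for a b
  proof (cases "lin_norm z a b < 1")
    case True
    then show ?thesis
      using noncrit fixed parameter unimod by (intro form_norm_pencil_path_point)
  next
    case False
    then have lin_norm_1: "lin_norm z a b = 1"
      using lin_norm_le_1[OF point unimod] by simp
    then have "form_norm z d (pencil a b f g) = 1"
      using forms_invariantD[OF invariant point] by simp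
    then have "form_norm (path_point z t) d (pencil a b f g) = 1"
      by (intro form_norm_path_point_eq_1 point parameter degree_pencil_f_g)
        (simp_all add: gauss_pencil unimod)
    then show ?thesis
      using parameter by (simp add: lin_norm_path_point[OF point parameter unimod] lin_norm_1)
  qed
  then show ?thesis
    using path_point_in_berk_P1[OF point parameter]
    by (simp add: fixed_locus_iff forms_invariant_def)
qed

lemma connectedin_fixed_locus:
  assumes noncrit: "\<not> red_has_fixed_crit absv f g"
  shows "connectedin (berk_P1_top absv) (berk_fixed_locus absv f g)"
proof -
  let ?F = "berk_fixed_locus absv f g"
  let ?path = "\<lambda>z. path_point z ` {0..1}"
  have point: "z \<in> berk_P1 absv" if "z \<in> ?F" for z
    using that by (simp add: fixed_locus_iff)
  have "connectedin (berk_P1_top absv) (?path z)" if "z \<in> ?F" for z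
    by (rule connectedin_continuous_map_image[OF continuous_map_path_point[OF point[OF that]]])
      (simp add: connectedin_subtopology)
  moreover have "Some gauss \<in> ?path z" if "z \<in> ?F" for z
    using path_point_1[OF point[OF that]] by (intro image_eqI[of _ _ 1]) auto
  then have "\<Inter> (?path ` ?F) \<noteq> {}"
    by blast
  ultimately have "connectedin (berk_P1_top absv) (\<Union> (?path ` ?F))"
    by (intro connectedin_Union) blast+
  moreover have "z \<in> ?path z" if "z \<in> ?F" for z
    using path_point_0[OF point[OF that]] by (intro image_eqI[of _ _ 0]) auto
  then have "\<Union> (?path ` ?F) = ?F"
    using path_point_fixed[OF noncrit] by fastforce
  ultimately show ?thesis
    by simp
qed

end

section \<open>Separation of critical fixed points\<close>

text \<open>The form \<open>Y F - X G\<close>, whose zeros are the fixed points of the map on \<open>\<P>\<^sup>1(L)\<close>.\<close>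
definition fixed_point_form :: "'a::field poly \<Rightarrow> 'a poly \<Rightarrow> 'a poly" where
  "fixed_point_form f g = lin (-1) 0 * f - lin 0 1 * g"

lemma degree_fixed_point_form:
  assumes "degree f \<le> n" "degree g \<le> n"
  shows "degree (fixed_point_form f g) \<le> Suc n"
  unfolding fixed_point_form_def using assms by (intro degree_diff_le degree_lin_mult)

lemma hom_eval_fixed_point_form:
  assumes "degree f \<le> n" "degree g \<le> n"
  shows "hom_eval (Suc n) (fixed_point_form f g) x y = hom_eval n (pencil x y f g) x y"
  using assms by (simp add: fixed_point_form_def hom_eval_diff hom_eval_lin_mult hom_eval_pencil)

context good_reduction_map
begin

text \<open>If \<open>Y F \<equiv> X G\<close>, then \<open>F \<equiv> X K\<close> and \<open>G \<equiv> Y K\<close> for a form \<open>K\<close> of degree \<open>d - 1 \<ge> 1\<close>.\<close>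
lemma gauss_fixed_point_form: "gauss (fixed_point_form f g) = 1"
proof (rule ccontr)
  let ?H = "fixed_point_form f g"
  assume "gauss ?H \<noteq> 1"
  have form_eq: "?H = f - [:0, 1:] * g"
    by (simp add: fixed_point_form_def lin_def)
  have gauss_X: "gauss [:0, 1:] = 1"
    by (simp add: gauss_norm_pCons)
  have "gauss ?H \<le> 1"
    using gauss_diff_le[of f "[:0, 1:] * g"] gauss_f_le gauss_g_le
    unfolding form_eq gauss_mult gauss_X by simp
  with \<open>gauss ?H \<noteq> 1\<close> have small: "gauss ?H < 1"
    by simp
  define c where "c = coeff g d"
  define K where "K = g - monom c d"
  have "coeff ?H (Suc d) = - c"
    using degree_f by (simp add: form_eq c_def coeff_eq_0)
  then have leading_small: "absv c < 1"
    using coeff_le_gauss[of ?H "Suc d"] small by simp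
  have g_K: "cong_m absv g (K * 1)"
    using leading_small by (simp add: cong_m_iff K_def)
  have "f - K * [:0, 1:] = ?H + [:0, 1:] * monom c d"
    by (simp add: form_eq K_def algebra_simps)
  then have f_K: "cong_m absv f (K * [:0, 1:])"
    using gauss_norm_add_le[of 1 ?H "[:0, 1:] * monom c d"] small leading_small
    unfolding cong_m_iff by (simp add: gauss_mult gauss_X del: mult_pCons_left)
  have "gauss K \<le> 1"
    using gauss_diff_le[of g "monom c d"] gauss_g_le leading_small by (simp add: K_def)
  moreover have "degree K \<le> d - 1"
    unfolding K_def c_def using degree_g by (intro degree_le) (auto simp: coeff_eq_0)
  moreover have "red_form_dvd absv (d - 1) K d f" "red_form_dvd absv (d - 1) K d g"
    using f_K g_K gauss_X rat_deg_ge_2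
    by (auto intro!: red_form_dvdI simp: one_pCons simp del: mult_pCons_right)
  ultimately have "d - 1 = 0"
    by (rule no_common_factor)
  then show False
    using rat_deg_ge_2 by simp
qed

lemma classical_fixed_point:
  assumes unimod: "unimodular c e" and zero: "hom_eval d (pencil c e f g) c e = 0"
  shows "chordal_disc c e 0 \<in> berk_fixed_locus absv f g"
proof -
  let ?C = "hom_eval d f c e" and ?E = "hom_eval d g c e"
  obtain u where "absv (?C - u * c) \<le> chordal c e ?C ?E" "absv (?E - u * e) \<le> chordal c e ?C ?E"
    using proportional_up_to_chordal[OF unimod] by blast
  moreover have "chordal c e ?C ?E = 0"
    using zero by (simp add: hom_eval_pencil chordal_def)
  ultimately have proportional: "?C = u * c" "?E = u * e"
    by simp_all
  have "max (absv ?C) (absv ?E) = absv u * max (absv c) (absv e)"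
    by (simp add: proportional absv_mult max_mult_distrib_left)
  then have "absv u = 1"
    using unimod unimodular_hom_eval[OF unimod] by (simp add: unimodular_def)
  have "form_norm (chordal_disc c e 0) d (pencil x y f g) = lin_norm (chordal_disc c e 0) x y"
    if "unimodular x y" for x y
  proof -
    have "form_norm (chordal_disc c e 0) d (pencil x y f g) = absv (y * ?C - x * ?E)"
      by (simp add: form_norm_chordal_disc_0[OF degree_pencil_f_g unimod] hom_eval_pencil)
    also have "y * ?C - x * ?E = u * (y * c - x * e)"
      by (simp add: proportional algebra_simps)
    also have "absv \<dots> = chordal x y c e"
      using \<open>absv u = 1\<close> by (simp add: absv_mult chordal_def)
    finally show ?thesis
      using that unimod by (simp add: lin_norm_chordal_disc chordal_def)
  qed
  then show ?thesis
    by (simp add: fixed_locus_iff forms_invariant_def chordal_disc_in_berk_P1)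
qed

lemma fixed_point_in_residue_class:
  assumes unimod: "unimodular a b" and small: "absv (hom_eval d (pencil a b f g) a b) < 1"
  obtains z where "z \<in> berk_fixed_locus absv f g" "lin_norm z a b < 1"
proof -
  have "absv (hom_eval (Suc d) (fixed_point_form f g) a b) < 1"
    using small by (simp add: hom_eval_fixed_point_form degree_f degree_g)
  then obtain m c e q where factor: "Suc d = Suc m" "degree q \<le> m" "unimodular c e"
    "chordal a b c e < 1" "fixed_point_form f g = lin c e * q"
    using form_factor_near_zero[OF degree_fixed_point_form[OF degree_f degree_g] unimod
        gauss_fixed_point_form] by metis
  have "hom_eval d (pencil c e f g) c e = hom_eval (Suc d) (lin c e * q) c e"
    by (simp add: factor(5)[symmetric] hom_eval_fixed_point_form degree_f degree_g)
  also have "\<dots> = 0"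
    using factor(1,2) by (simp add: hom_eval_lin_mult)
  finally have "chordal_disc c e 0 \<in> berk_fixed_locus absv f g"
    using factor(3) by (intro classical_fixed_point)
  moreover have "lin_norm (chordal_disc c e 0) a b < 1"
    using factor(3,4) unimod by (simp add: lin_norm_chordal_disc)
  ultimately show thesis
    by (rule that)
qed

lemma lin_norm_fixed_point_gap:
  assumes fixed: "z \<in> berk_fixed_locus absv f g" and unimod: "unimodular a b"
    and quotient: "gauss q \<le> 1" "degree q \<le> d - 2"
    and near: "lin_norm z a b < 1"
  shows "lin_norm z a b \<le> gauss (pencil a b f g - lin a b ^ 2 * q)"
proof -
  define s where "s = lin_norm z a b"
  define E where "E = pencil a b f g - lin a b ^ 2 * q"
  have point: "z \<in> berk_P1 absv"
    using fixed by (simp add: fixed_locus_iff)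
  have s_bounds: "0 \<le> s" "s < 1"
    using near lin_norm_nonneg[OF point] by (simp_all add: s_def)
  have d_eq: "d = 2 + (d - 2)"
    using rat_deg_ge_2 by simp
  have "degree (lin a b ^ 2 * q) \<le> d"
    using degree_lin_mult[OF degree_lin_mult[OF quotient(2)], of a b a b] d_eq
    by (simp add: power2_eq_square mult.assoc)
  then have "form_norm z d E \<le> gauss E"
    unfolding E_def by (intro form_norm_le_gauss point degree_diff_le degree_pencil_f_g)
  moreover have "form_norm z d (lin a b ^ 2 * q) \<le> s\<^sup>2"
    using form_norm_square_mult_le[OF point quotient, of a b] d_eq by (simp add: s_def)
  moreover have "s = form_norm z d (E + lin a b ^ 2 * q)"
    using fixed unimod by (simp add: fixed_locus_iff forms_invariant_def E_def s_def)
  ultimately have "s \<le> gauss E \<or> s \<le> s * s"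
    using form_norm_add_le[OF point, of d E "lin a b ^ 2 * q"]
    unfolding power2_eq_square by linarith
  moreover have "s = 0" if "s \<le> s * s"
    using that s_bounds mult_le_cancel_left1[of s s] by fastforce
  ultimately show ?thesis
    unfolding s_def[symmetric] E_def[symmetric] by (metis gauss_norm_nonneg zero_le_one)
qed

lemma not_connectedin_fixed_locus:
  assumes "red_has_fixed_crit absv f g"
  shows "\<not> connectedin (berk_P1_top absv) (berk_fixed_locus absv f g)"
proof
  let ?F = "berk_fixed_locus absv f g"
  assume "connectedin (berk_P1_top absv) ?F"
  obtain a b where unimod: "unimodular a b"
    and double: "red_form_dvd absv 2 (lin a b ^ 2) d (pencil a b f g)"
    using assms by (rule red_has_fixed_critD)
  obtain q where quotient: "gauss q \<le> 1" "degree q \<le> d - 2"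
    and remainder: "cong_m absv (pencil a b f g) (lin a b ^ 2 * q)"
    using double by (rule red_form_dvdE)
  define \<rho> where "\<rho> = gauss (pencil a b f g - lin a b ^ 2 * q)"
  have "\<rho> < 1"
    using remainder by (simp add: cong_m_iff \<rho>_def)
  have gap: "lin_norm z a b \<le> \<rho> \<or> 1 \<le> lin_norm z a b" if "z \<in> ?F" for z
    using lin_norm_fixed_point_gap[OF that unimod quotient] by (force simp: \<rho>_def)
  obtain z where "z \<in> ?F" "lin_norm z a b < 1"
    using fixed_point_in_residue_class[OF unimod]
      absv_hom_eval_less_1_if_square_dvd[OF unimod double] by blast
  have "connected ((\<lambda>z. lin_norm z a b) ` ?F)"
    using connectedin_continuous_map_image[OF continuous_map_lin_norm \<open>connectedin _ ?F\<close>] by simp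
  moreover have "1 \<in> (\<lambda>z. lin_norm z a b) ` ?F"
    using gauss_point_fixed lin_norm_gauss[OF unimod] by force
  ultimately have "{lin_norm z a b..1} \<subseteq> (\<lambda>z. lin_norm z a b) ` ?F"
    using \<open>z \<in> ?F\<close> by (intro connected_contains_Icc) auto
  moreover have "(\<rho> + 1) / 2 \<in> {lin_norm z a b..1}"
    using gap[OF \<open>z \<in> ?F\<close>] \<open>lin_norm z a b < 1\<close> \<open>\<rho> < 1\<close> by auto
  ultimately have "(\<rho> + 1) / 2 \<in> (\<lambda>z. lin_norm z a b) ` ?F"
    by (rule subsetD)
  then obtain y where "y \<in> ?F" "(\<rho> + 1) / 2 = lin_norm y a b"
    by (rule imageE)
  then show False
    using gap[of y] \<open>\<rho> < 1\<close> by auto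
qed

end

theorem theorem3p2:
  fixes absv :: "'a::field_char_0 \<Rightarrow> real" and f g :: "'a poly"
  assumes "nonarch_abs absv" and "complete_abs absv" and "alg_closed_field TYPE('a)"
    and "coprime f g" and "2 \<le> rat_deg f g"
    and "normalized absv f g"
    and "good_reduction absv f g"
  shows "connectedin (berk_P1_top absv) (berk_fixed_locus absv f g)
           \<longleftrightarrow> \<not> red_has_fixed_crit absv f g"
proof -
  interpret good_reduction_map absv f g
    by unfold_locales (use assms in auto)
  show ?thesis
    using connectedin_fixed_locus not_connectedin_fixed_locus by blast
qed

end
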